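(* Let $\alpha\ge1$ be an integer and let $P_0=\{(i,j,k)\in[1,2\alpha]^3:\ \text{at most one of } i,j,k \text{ exceeds } \alpha\}$. Consider the set of totally symmetric self--complementary plane partitions $P$ contained in the box $[1,2\alpha]^3$, and let $n(P)$ be the number of orbits of the symmetric group $S_3$ acting on $[1,2\alpha]^3$ by permuting coordinates that are contained in $P$ but not contained in $P_0$. Then $$\sum_P(-1)^{n(P)}=\begin{cases}\displaystyle\prod_{k=1}^{(\alpha-1)/2}\frac{(6k-2)!}{(2k+\alpha-1)!} & \text{if $\alpha$ is odd},\\ 0 & \text{if $\alpha$ is even.}\end{cases}$$
   Context: A plane partition is a finite set $P$ of points $(i,j,k)$ with positive integer coordinates such that if $(i,j,k)\in P$ and $1\le i'\le i$, $1\le j'\le j$, $1\le k'\le k$, then $(i',j',k')\in P$. $P$ is contained in the box $[1,2\alpha]^3$ if all coordinates of its points are at most $2\alpha$. $P$ is totally symmetric if it is invariant under all permutations of coordinates. $P$ (in the box $2\alpha\times2\alpha\times2\alpha$) is self--complementary if whenever $(i,j,k)\in P$ then $(2\alpha+1-i,2\alpha+1-j,2\alpha+1-k)\notin P$, for $1\le i,j,k\le2\alpha$. The set $P_0$ is itself a totally symmetric self--complementary plane partition (it has weight $1$). Empty products equal $1$.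
   Formalization: "Self-complementary" is taken as an equivalence: of two opposite points of the box exactly one lies in P. With the one-way implication as worded, the empty set and {(1,1,1)} would also count for α = 1, and the sum would be 3 instead of 1. *)

theory Defs
  imports Complex_Main
begin

type_synonym point = "nat \<times> nat \<times> nat"

definition cube :: "nat \<Rightarrow> point set" where
  "cube m = {1..m} \<times> {1..m} \<times> {1..m}"

definition plane_partition :: "point set \<Rightarrow> bool" where
  "plane_partition P \<longleftrightarrow> finite P \<and>
     (\<forall>i j k. (i, j, k) \<in> P \<longrightarrow> 1 \<le> i \<and> 1 \<le> j \<and> 1 \<le> k) \<and>
     (\<forall>i j k i' j' k'. (i, j, k) \<in> P \<longrightarrow>
        1 \<le> i' \<longrightarrow> i' \<le> i \<longrightarrow> 1 \<le> j' \<longrightarrow> j' \<le> j \<longrightarrow> 1 \<le> k' \<longrightarrow> k' \<le> k \<longrightarrow>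
        (i', j', k') \<in> P)"

fun S3_orbit :: "point \<Rightarrow> point set" where
  "S3_orbit (i, j, k) = {(i, j, k), (i, k, j), (j, i, k), (j, k, i), (k, i, j), (k, j, i)}"

definition totally_symmetric :: "point set \<Rightarrow> bool" where
  "totally_symmetric P \<longleftrightarrow> (\<forall>x\<in>P. S3_orbit x \<subseteq> P)"

text \<open>Self-complementarity is an equivalence: of any two opposite points of the cube, exactly
  one lies in \<open>P\<close>. The implication from left to right alone would also admit, for
  instance, the empty set.\<close>

definition self_complementary :: "nat \<Rightarrow> point set \<Rightarrow> bool" where
  "self_complementary m P \<longleftrightarrow>
     (\<forall>(i, j, k) \<in> cube m. (i, j, k) \<in> P \<longleftrightarrow> (m + 1 - i, m + 1 - j, m + 1 - k) \<notin> P)"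

definition TSSCPP :: "nat \<Rightarrow> point set set" where
  "TSSCPP \<alpha> = {P. plane_partition P \<and> P \<subseteq> cube (2 * \<alpha>) \<and>
                   totally_symmetric P \<and> self_complementary (2 * \<alpha>) P}"

definition P0 :: "nat \<Rightarrow> point set" where
  "P0 \<alpha> = {(i, j, k) \<in> cube (2 * \<alpha>).
             \<not> (i > \<alpha> \<and> j > \<alpha>) \<and> \<not> (i > \<alpha> \<and> k > \<alpha>) \<and> \<not> (j > \<alpha> \<and> k > \<alpha>)}"

definition n_orbits :: "nat \<Rightarrow> point set \<Rightarrow> nat" where
  "n_orbits \<alpha> P = card {orb \<in> S3_orbit ` cube (2 * \<alpha>). orb \<subseteq> P \<and> \<not> orb \<subseteq> P0 \<alpha>}"

end

theory Submission
  imports Defs "HOL-Computational_Algebra.Polynomial"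
begin

text \<open>
  A partition \<open>P\<close> is determined by its orbits outside \<open>P\<^sub>0\<close>, which form an order ideal in the cells
  \<open>(a, b, k)\<close> with \<open>a + b + k < N = \<alpha> - 1\<close>. Cut along the diagonals \<open>k = const\<close>, such an ideal is the
  history of \<open>N\<close> nonintersecting particles. In the exterior algebra a time step multiplies by
  \<open>1 + w x\<close>, and configurations with two colliding particles vanish, so for every alternating form
  \<open>\<Phi>\<close> the weighted sum of \<open>\<Phi>\<close> over the final states is \<open>\<Phi>(f\<^sub>N, \<dots>, f\<^sub>1)\<close>, where
  \<open>f\<^sub>i = x^(i-1) (1 - x) (1 + x) (1 - x) \<dots>\<close> has \<open>i\<close> alternating linear factors. Taking for \<open>\<Phi>\<close> the
  Pfaffian of the form that equals \<open>1\<close> on \<open>(x^p, x^q)\<close> for \<open>p > q\<close> turns the signed count into a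
  Pfaffian of the \<open>f\<^sub>i\<close>.

  For odd \<open>N\<close> one adds a monomial of large degree, on which every \<open>f\<^sub>i\<close> is orthogonal because
  \<open>f\<^sub>i(1) = 0\<close>. For even \<open>N\<close> the \<open>f\<^sub>i\<close> with odd \<open>i\<close> span an isotropic space, and the pairing between
  odd and even indices is, up to sign, the Mills-Robbins-Rumsey matrix \<open>binomial(i + j + 1, 2 i - j)\<close>. An
  explicit hypergeometric triangular change of basis makes it triangular; the pivots are found by
  creative telescoping.
\<close>

subsection \<open>Alternating forms and Pfaffians\<close>

text \<open>Lists let one form take any number of vectors, with a slot addressed by a split of the
  list. Vanishing on adjacent repetitions suffices, since transpositions bring equal arguments
  together.\<close>

definition alternating_form :: "('a::comm_ring_1 poly list \<Rightarrow> 'a) \<Rightarrow> bool" where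
  "alternating_form \<Phi> \<longleftrightarrow>
     (\<forall>as c x y bs. \<Phi> (as @ (smult c x + y) # bs) = c * \<Phi> (as @ x # bs) + \<Phi> (as @ y # bs)) \<and>
     (\<forall>as x bs. \<Phi> (as @ x # x # bs) = 0)"

lemma alternating_form_linear:
  "alternating_form \<Phi> \<Longrightarrow> \<Phi> (as @ (smult c x + y) # bs) = c * \<Phi> (as @ x # bs) + \<Phi> (as @ y # bs)"
  by (auto simp: alternating_form_def)

lemma alternating_form_adjacent: "alternating_form \<Phi> \<Longrightarrow> \<Phi> (as @ x # x # bs) = 0"
  by (auto simp: alternating_form_def)

lemma alternating_form_add:
  "alternating_form \<Phi> \<Longrightarrow> \<Phi> (as @ (x + y) # bs) = \<Phi> (as @ x # bs) + \<Phi> (as @ y # bs)"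
  using alternating_form_linear[of \<Phi> as 1 x y bs] by simp

text \<open>Polarization: expand the form at two adjacent copies of \<open>x + y\<close>, where it
  vanishes.\<close>

lemma alternating_form_swap:
  assumes "alternating_form \<Phi>"
  shows "\<Phi> (as @ x # y # bs) = - \<Phi> (as @ y # x # bs)"
proof -
  have "0 = \<Phi> (as @ (x + y) # (x + y) # bs)"
    using assms by (simp add: alternating_form_adjacent)
  also have "\<dots> = \<Phi> (as @ x # (x + y) # bs) + \<Phi> (as @ y # (x + y) # bs)"
    by (rule alternating_form_add[OF assms])
  also have "\<Phi> (as @ x # (x + y) # bs) = \<Phi> (as @ x # y # bs)"
    using alternating_form_add[OF assms, of "as @ [x]" x y bs] alternating_form_adjacent[OF assms]
    by simp
  also have "\<Phi> (as @ y # (x + y) # bs) = \<Phi> (as @ y # x # bs)"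
    using alternating_form_add[OF assms, of "as @ [y]" x y bs] alternating_form_adjacent[OF assms]
    by simp
  finally show ?thesis by (simp add: eq_neg_iff_add_eq_0)
qed

lemma alternating_form_repeated:
  assumes "alternating_form \<Phi>"
  shows "\<Phi> (as @ x # bs @ x # cs) = 0"
proof (induction bs arbitrary: as)
  case Nil
  then show ?case using alternating_form_adjacent[OF assms] by simp
next
  case (Cons b bs)
  then show ?case
    using alternating_form_swap[OF assms, of as x b "bs @ x # cs"] Cons.IH[of "as @ [b]"] by simp
qed

text \<open>A column operation: each added multiple repeats a vector already present to the right of
  the slot.\<close>

lemma alternating_form_add_combination:
  assumes \<Phi>: "alternating_form \<Phi>" and "finite I" and "\<And>i. i \<in> I \<Longrightarrow> x i \<in> set bs"
  shows "\<Phi> (as @ (y + (\<Sum>i\<in>I. smult (c i) (x i))) # bs) = \<Phi> (as @ y # bs)"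
  using assms(2,3)
proof (induction I rule: finite_induct)
  case empty
  then show ?case by simp
next
  case (insert i I)
  obtain bs1 bs2 where bs: "bs = bs1 @ x i # bs2"
    using insert.prems[of i] by (auto simp: in_set_conv_decomp)
  have eq: "y + (\<Sum>i\<in>insert i I. smult (c i) (x i)) =
      smult (c i) (x i) + (y + (\<Sum>i\<in>I. smult (c i) (x i)))"
    using insert.hyps by (simp add: add_ac)
  have "\<Phi> (as @ x i # bs) = 0"
    unfolding bs by (rule alternating_form_repeated[OF \<Phi>])
  then show ?case
    unfolding eq alternating_form_linear[OF \<Phi>] using insert.IH insert.prems by simp
qed

text \<open>\<open>J\<close> records the slots in which the second summand is chosen. The induction
  peels off the last slot, which then joins the free tail \<open>ys\<close>.\<close>

lemma alternating_form_expand: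
  assumes \<Phi>: "alternating_form \<Phi>"
  shows "\<Phi> (map (\<lambda>a. f a + smult w (h a)) [0..<n] @ ys) =
    (\<Sum>J\<in>Pow {..<n}. w ^ card J * \<Phi> (map (\<lambda>a. if a \<in> J then h a else f a) [0..<n] @ ys))"
proof (induction n arbitrary: ys)
  case 0
  then show ?case by simp
next
  case (Suc n)
  let ?m = "\<lambda>J n. map (\<lambda>a. if a \<in> J then h a else f a) [0..<n]"
  have inj: "inj_on (insert n) (Pow {..<n})"
    by (rule inj_onI) (metis PowD insert_ident lessThan_iff less_irrefl subset_iff)
  have m_insert: "?m (insert n J) n = ?m J n" for J by (intro map_cong) auto
  have "\<Phi> (map (\<lambda>a. f a + smult w (h a)) [0..<Suc n] @ ys) =
      w * \<Phi> (map (\<lambda>a. f a + smult w (h a)) [0..<n] @ h n # ys) +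
      \<Phi> (map (\<lambda>a. f a + smult w (h a)) [0..<n] @ f n # ys)"
    using alternating_form_linear[OF \<Phi>, of _ w "h n" "f n" ys] by (simp add: add.commute)
  also have "\<dots> = (\<Sum>J\<in>Pow {..<n}. w ^ Suc (card J) * \<Phi> (?m J n @ h n # ys)) +
      (\<Sum>J\<in>Pow {..<n}. w ^ card J * \<Phi> (?m J n @ f n # ys))"
    by (simp add: Suc.IH sum_distrib_left mult.assoc)
  also have "(\<Sum>J\<in>Pow {..<n}. w ^ Suc (card J) * \<Phi> (?m J n @ h n # ys)) =
      (\<Sum>J\<in>insert n ` Pow {..<n}. w ^ card J * \<Phi> (?m J (Suc n) @ ys))"
    unfolding sum.reindex[OF inj]
  proof (rule sum.cong[OF refl])
    fix J assume "J \<in> Pow {..<n}"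
    then have "finite J" "n \<notin> J" by (auto intro: finite_subset)
    moreover have "?m (insert n J) (Suc n) = ?m J n @ [h n]"
      using m_insert[of J] by simp
    ultimately show "w ^ Suc (card J) * \<Phi> (?m J n @ h n # ys) =
        ((\<lambda>J. w ^ card J * \<Phi> (?m J (Suc n) @ ys)) \<circ> insert n) J"
      by (simp only: comp_def card_insert_disjoint append_assoc append_Cons append_Nil not_False_eq_True)
  qed
  also have "(\<Sum>J\<in>Pow {..<n}. w ^ card J * \<Phi> (?m J n @ f n # ys)) =
      (\<Sum>J\<in>Pow {..<n}. w ^ card J * \<Phi> (?m J (Suc n) @ ys))"
    by (rule sum.cong) auto
  also have "(\<Sum>J\<in>insert n ` Pow {..<n}. w ^ card J * \<Phi> (?m J (Suc n) @ ys)) +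
      (\<Sum>J\<in>Pow {..<n}. w ^ card J * \<Phi> (?m J (Suc n) @ ys)) =
      (\<Sum>J\<in>Pow {..<Suc n}. w ^ card J * \<Phi> (?m J (Suc n) @ ys))"
    unfolding lessThan_Suc Pow_insert
    by (subst sum.union_disjoint) (auto simp: add.commute)
  finally show ?case .
qed

section \<open>Pfaffians of lists of vectors\<close>

definition del_nth :: "nat \<Rightarrow> 'a list \<Rightarrow> 'a list" where
  "del_nth j xs = take j xs @ drop (Suc j) xs"

lemma length_del_nth: "j < length xs \<Longrightarrow> length (del_nth j xs) = length xs - 1"
  by (auto simp: del_nth_def)

lemma del_nth_append1: "j < length xs \<Longrightarrow> del_nth j (xs @ ys) = del_nth j xs @ ys"
  by (simp add: del_nth_def)

lemma del_nth_append2: "del_nth (length xs + j) (xs @ ys) = xs @ del_nth j ys"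
  by (simp add: del_nth_def)

lemma del_nth_Cons [simp]: "del_nth 0 (x # xs) = xs" "del_nth (Suc j) (x # xs) = x # del_nth j xs"
  by (simp_all add: del_nth_def)

lemma nth_del_nth:
  "j < length xs \<Longrightarrow> l < length xs - 1 \<Longrightarrow> del_nth j xs ! l = (if l < j then xs ! l else xs ! Suc l)"
  by (auto simp: del_nth_def nth_append)

lemma del_nth_del_nth:
  assumes "l < j" "j < length xs"
  shows "del_nth l (del_nth j xs) = del_nth (j - 1) (del_nth l xs)"
  by (rule nth_equalityI) (use assms in \<open>auto simp: length_del_nth nth_del_nth\<close>)

text \<open>Expansion along the first vector, paired with each later one in turn. Lists of odd
  length get \<open>0\<close>, because the recursion ends in a singleton and there in an empty
  sum.\<close>

function pfaffian :: "('v \<Rightarrow> 'v \<Rightarrow> 'a::comm_ring_1) \<Rightarrow> 'v list \<Rightarrow> 'a" where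
  "pfaffian \<omega> [] = 1"
| "pfaffian \<omega> (x # ys) =
     (\<Sum>j<length ys. (- 1) ^ j * \<omega> x (ys ! j) * pfaffian \<omega> (del_nth j ys))"
  by pat_completeness auto
termination by (relation "measure (\<lambda>(\<omega>, xs). length xs)") (auto simp: length_del_nth)

lemma sum_lessThan_add:
  fixes f :: "nat \<Rightarrow> 'a::comm_monoid_add"
  shows "(\<Sum>j<m + n. f j) = (\<Sum>j<m. f j) + (\<Sum>j<n. f (m + j))"
  by (induction n) (simp_all add: add.assoc)

text \<open>Separates the term that pairs \<open>a\<close> with a marked entry \<open>y\<close>; in
  the other terms \<open>y\<close> keeps its place in a shorter list, ready for induction on the
  length.\<close>

lemma pfaffian_split:
  "pfaffian \<omega> (a # as @ y # bs) =
    (\<Sum>j<length as. (- 1) ^ j * \<omega> a (as ! j) * pfaffian \<omega> (del_nth j as @ y # bs)) +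
    (- 1) ^ length as * \<omega> a y * pfaffian \<omega> (as @ bs) +
    (\<Sum>j<length bs. (- 1) ^ (length as + Suc j) * \<omega> a (bs ! j) *
       pfaffian \<omega> (as @ y # del_nth j bs))"
proof -
  let ?t = "\<lambda>j. (- 1) ^ j * \<omega> a ((as @ y # bs) ! j) * pfaffian \<omega> (del_nth j (as @ y # bs))"
  have "pfaffian \<omega> (a # as @ y # bs) = (\<Sum>j<length as + Suc (length bs). ?t j)"
    by simp
  also have "\<dots> = (\<Sum>j<length as. ?t j) + (?t (length as) + (\<Sum>j<length bs. ?t (length as + Suc j)))"
    by (simp only: sum_lessThan_add sum.lessThan_Suc_shift comp_def add_0_right)
  also have "?t (length as) = (- 1) ^ length as * \<omega> a y * pfaffian \<omega> (as @ bs)"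
    using del_nth_append2[of as 0 "y # bs"] by simp
  also have "(\<Sum>j<length bs. ?t (length as + Suc j)) =
    (\<Sum>j<length bs. (- 1) ^ (length as + Suc j) * \<omega> a (bs ! j) *
       pfaffian \<omega> (as @ y # del_nth j bs))"
    by (intro sum.cong refl) (simp only: del_nth_append2 nth_append_length_plus nth_Cons_Suc del_nth_Cons)
  also have "(\<Sum>j<length as. ?t j) =
      (\<Sum>j<length as. (- 1) ^ j * \<omega> a (as ! j) * pfaffian \<omega> (del_nth j as @ y # bs))"
    by (intro sum.cong refl) (simp add: del_nth_append1 nth_append)
  finally show ?thesis by (simp only: add.assoc)
qed

text \<open>\<open>l\<close> counts positions after the removal of \<open>j\<close>, so removing the
  same two entries in the other order turns \<open>(j, l)\<close> with \<open>l < j\<close> into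
  \<open>(l, j - 1)\<close>.\<close>

lemma sum_cross_cancel:
  fixes f :: "nat \<Rightarrow> nat \<Rightarrow> 'a::ab_group_add"
  assumes "\<And>j l. l < j \<Longrightarrow> j < n \<Longrightarrow> f l (j - 1) = - f j l"
  shows "(\<Sum>j<n. \<Sum>l<n - 1. f j l) = 0"
proof -
  let ?L = "{(j, l). l < j \<and> j < n}" and ?U = "{(j, l). j \<le> l \<and> l < n - 1}"
  have fin: "finite ?L" "finite ?U"
    by (rule finite_subset[of _ "{..<n} \<times> {..<n}"]; auto)+
  have "(\<Sum>j<n. \<Sum>l<n - 1. f j l) = (\<Sum>(j, l)\<in>{..<n} \<times> {..<n - 1}. f j l)"
    by (simp add: sum.cartesian_product)
  also have "{..<n} \<times> {..<n - 1} = ?L \<union> ?U" by auto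
  also have "(\<Sum>(j, l)\<in>?L \<union> ?U. f j l) = (\<Sum>(j, l)\<in>?L. f j l) + (\<Sum>(j, l)\<in>?U. f j l)"
    by (rule sum.union_disjoint) (use fin in auto)
  also have "(\<Sum>(j, l)\<in>?U. f j l) = (\<Sum>(j, l)\<in>?L. - f j l)"
    by (rule sum.reindex_bij_witness[where i = "\<lambda>(j, l). (l, j - 1)" and j = "\<lambda>(j, l). (Suc l, j)"])
      (use assms[of _ "Suc _"] in auto)
  finally show ?thesis by (simp add: sum_negf split_def)
qed

locale alternating_pairing =
  fixes \<omega> :: "'a::comm_ring_1 poly \<Rightarrow> 'a poly \<Rightarrow> 'a"
  assumes linear_left: "\<omega> (smult c x + y) z = c * \<omega> x z + \<omega> y z"
    and linear_right: "\<omega> z (smult c x + y) = c * \<omega> z x + \<omega> z y"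
    and alternating: "\<omega> x x = 0"
begin

lemma pfaffian_linear:
  "pfaffian \<omega> (as @ (smult c x + y) # bs) =
     c * pfaffian \<omega> (as @ x # bs) + pfaffian \<omega> (as @ y # bs)"
proof (induction "length as + length bs" arbitrary: as bs rule: less_induct)
  case less
  show ?case
  proof (cases as)
    case Nil
    show ?thesis
      unfolding Nil append_Nil pfaffian.simps linear_left
      by (simp add: sum.distrib algebra_simps sum_distrib_left)
  next
    case (Cons a as')
    have "pfaffian \<omega> (as' @ (smult c x + y) # del_nth j bs) =
        c * pfaffian \<omega> (as' @ x # del_nth j bs) + pfaffian \<omega> (as' @ y # del_nth j bs)"
      if "j < length bs" for j
      using less[of as' "del_nth j bs"] that by (simp add: Cons length_del_nth)
    moreover have "pfaffian \<omega> (del_nth j as' @ (smult c x + y) # bs) =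
        c * pfaffian \<omega> (del_nth j as' @ x # bs) + pfaffian \<omega> (del_nth j as' @ y # bs)"
      if "j < length as'" for j
      using less[of "del_nth j as'" bs] that by (simp add: Cons length_del_nth)
    ultimately show ?thesis
      unfolding Cons append_Cons pfaffian_split linear_right
      by (simp add: sum.distrib sum_negf sum_subtractf sum_distrib_left algebra_simps)
  qed
qed

text \<open>If the equal vectors come first, they are paired with two other entries, and exchanging
  these partners reverses the sign. Otherwise expand along the first vector.\<close>

lemma pfaffian_adjacent: "pfaffian \<omega> (as @ x # x # bs) = 0"
proof (induction "length as + length bs" arbitrary: as bs rule: less_induct)
  case less
  show ?case
  proof (cases as)
    case Nil
    let ?n = "length bs"
    have "pfaffian \<omega> (x # x # bs) = (\<Sum>j<?n. (- 1) ^ Suc j * \<omega> x (bs ! j) * pfaffian \<omega> (x # del_nth j bs))"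
      using pfaffian_split[of \<omega> x "[]" x bs] by (simp add: alternating)
    also have "\<dots> = (\<Sum>j<?n. \<Sum>l<?n - 1. (- 1) ^ Suc (j + l) * \<omega> x (bs ! j) *
        \<omega> x (del_nth j bs ! l) * pfaffian \<omega> (del_nth l (del_nth j bs)))"
      by (intro sum.cong refl) (simp add: length_del_nth sum_distrib_left power_add mult_ac sum_negf)
    also have "\<dots> = 0"
    proof (rule sum_cross_cancel)
      fix j l assume "l < j" "j < ?n"
      then obtain j' where "j = Suc j'" by (cases j) auto
      with \<open>l < j\<close> \<open>j < ?n\<close> show "(- 1) ^ Suc (l + (j - 1)) * \<omega> x (bs ! l) *
        \<omega> x (del_nth l bs ! (j - 1)) * pfaffian \<omega> (del_nth (j - 1) (del_nth l bs)) =
        - ((- 1) ^ Suc (j + l) * \<omega> x (bs ! j) *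
        \<omega> x (del_nth j bs ! l) * pfaffian \<omega> (del_nth l (del_nth j bs)))"
        by (simp add: nth_del_nth del_nth_del_nth power_add mult_ac)
    qed
    finally show ?thesis by (simp add: Nil)
  next
    case (Cons a as')
    have "pfaffian \<omega> (as' @ x # x # del_nth j bs) = 0" if "j < length bs" for j
      using less[of as' "del_nth j bs"] that by (simp add: Cons length_del_nth)
    moreover have "pfaffian \<omega> (del_nth j as' @ x # x # bs) = 0" if "j < length as'" for j
      using less[of "del_nth j as'" bs] that by (simp add: Cons length_del_nth)
    \<comment> \<open>Pairing \<open>a\<close> with either copy of \<open>x\<close> leaves the same
      list with opposite signs; the index shift exposes the second of these terms.\<close>
    ultimately show ?thesis
      unfolding Cons append_Cons pfaffian_split
      by (simp add: sum.lessThan_Suc_shift del: sum.lessThan_Suc)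
  qed
qed

lemma alternating_form_pfaffian: "alternating_form (pfaffian \<omega>)"
  by (simp add: alternating_form_def pfaffian_linear pfaffian_adjacent del: pfaffian.simps)

end

text \<open>The expansion is an alternating sum of an odd number of ones. This gives every final
  state the weight \<open>1\<close>.\<close>

lemma pfaffian_ones:
  assumes "even (length xs)"
    and "\<And>i j. i < j \<Longrightarrow> j < length xs \<Longrightarrow> \<omega> (xs ! i) (xs ! j) = 1"
  shows "pfaffian \<omega> xs = 1"
  using assms
proof (induction "length xs" arbitrary: xs rule: less_induct)
  case less
  show ?case
  proof (cases xs)
    case (Cons x ys)
    have one: "pfaffian \<omega> (del_nth j ys) = 1" if "j < length ys" for j
    proof (rule less.hyps)
      fix i l assume "i < l" "l < length (del_nth j ys)"
      then show "\<omega> (del_nth j ys ! i) (del_nth j ys ! l) = 1"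
        using less.prems(2)[of "Suc (if i < j then i else Suc i)" "Suc (if l < j then l else Suc l)"] that
        by (auto simp: Cons nth_del_nth length_del_nth split: if_splits)
    qed (use that less.prems(1) Cons in \<open>auto simp: length_del_nth\<close>)
    have alt: "(\<Sum>j<n. (- 1) ^ j :: 'b) = (if odd n then 1 else 0)" for n
      by (induction n) auto
    have "pfaffian \<omega> xs = (\<Sum>j<length ys. (- 1) ^ j)"
      using less.prems(2)[of 0 "Suc _"] one by (simp add: Cons)
    with less.prems(1) show ?thesis by (simp add: alt Cons)
  qed simp
qed

subsection \<open>Particle histories\<close>

text \<open>\<open>(a, t) \<in> E\<close> means that particle \<open>a\<close>, born at time \<open>a + 1\<close>, jumps one place further at time \<open>t\<close>;
  at time \<open>t\<close> it sits at position \<open>rank E a t + (t - a - 1)\<close>, so the order condition is exclusion.\<close>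

definition rank :: "(nat \<times> nat) set \<Rightarrow> nat \<Rightarrow> nat \<Rightarrow> nat" where
  "rank E a t = card {s. s \<le> t \<and> (a, s) \<in> E}"

definition histories :: "nat \<Rightarrow> (nat \<times> nat) set set" where
  "histories N = {E. E \<subseteq> {(a, t). a < t \<and> t \<le> N} \<and> (\<forall>a t. rank E (Suc a) t \<le> rank E a t)}"

lemma rank_mono: "t \<le> t' \<Longrightarrow> rank E a t \<le> rank E a t'"
  unfolding rank_def by (rule card_mono) auto

lemma rank_0: "E \<subseteq> {(a, t). a < t \<and> t \<le> N} \<Longrightarrow> rank E a 0 = 0"
  by (auto simp: rank_def)

lemma rank_Suc: "rank E a (Suc t) = rank E a t + of_bool ((a, Suc t) \<in> E)"
proof -
  have "{s. s \<le> Suc t \<and> (a, s) \<in> E} =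
      (if (a, Suc t) \<in> E then insert (Suc t) {s. s \<le> t \<and> (a, s) \<in> E} else {s. s \<le> t \<and> (a, s) \<in> E})"
    by (auto simp: le_Suc_eq)
  then show ?thesis by (simp add: rank_def)
qed

lemma rank_beyond:
  assumes "E \<subseteq> {(a, t). a < t \<and> t \<le> N}" "N \<le> t"
  shows "rank E a t = rank E a N"
proof -
  have "{s. s \<le> t \<and> (a, s) \<in> E} = {s. s \<le> N \<and> (a, s) \<in> E}" using assms by auto
  then show ?thesis by (simp add: rank_def)
qed

lemma rank_eq_0: "E \<subseteq> {(a, t). a < t \<and> t \<le> N} \<Longrightarrow> t \<le> a \<Longrightarrow> rank E a t = 0"
  by (fastforce simp: rank_def)

lemma rank_le:
  assumes "E \<subseteq> {(a, t). a < t \<and> t \<le> N}"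
  shows "rank E a t \<le> t - a"
proof -
  have "{s. s \<le> t \<and> (a, s) \<in> E} \<subseteq> {Suc a..t}" using assms by auto
  from card_mono[OF _ this] show ?thesis by (simp add: rank_def)
qed

lemma finite_triangle: "finite {(a, t). a < t \<and> t \<le> (N::nat)}"
  by (rule finite_subset[of _ "{..N} \<times> {..N}"]) auto

lemma histories_subset: "E \<in> histories N \<Longrightarrow> E \<subseteq> {(a, t). a < t \<and> t \<le> N}"
  by (simp add: histories_def)

lemma finite_histories: "finite (histories N)"
  by (rule finite_subset[of _ "Pow {(a, t). a < t \<and> t \<le> N}"])
    (auto simp: histories_def finite_triangle)

section \<open>Extending histories by one time step\<close>

definition add_level :: "nat \<Rightarrow> (nat \<times> nat) set \<Rightarrow> nat set \<Rightarrow> (nat \<times> nat) set" where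
  "add_level N E J = E \<union> J \<times> {Suc N}"

lemma rank_add_level:
  assumes "E \<subseteq> {(a, t). a < t \<and> t \<le> N}"
  shows "t \<le> N \<Longrightarrow> rank (add_level N E J) a t = rank E a t"
    and "rank (add_level N E J) a (Suc N) = rank E a N + of_bool (a \<in> J)"
proof -
  show eq: "rank (add_level N E J) a t = rank E a t" if "t \<le> N" for t
  proof -
    have "{s. s \<le> t \<and> (a, s) \<in> add_level N E J} = {s. s \<le> t \<and> (a, s) \<in> E}"
      using that by (auto simp: add_level_def)
    then show ?thesis by (simp add: rank_def)
  qed
  have "(a, Suc N) \<in> add_level N E J \<longleftrightarrow> a \<in> J"
    using assms by (auto simp: add_level_def)
  then show "rank (add_level N E J) a (Suc N) = rank E a N + of_bool (a \<in> J)"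
    by (simp add: rank_Suc eq)
qed

text \<open>Earlier ranks are unchanged and later ones repeat the rank at \<open>Suc N\<close>, so
  exclusion is at stake only at the new time.\<close>

lemma add_level_in_histories_iff:
  assumes "E \<in> histories N" "J \<subseteq> {..N}"
  shows "add_level N E J \<in> histories (Suc N) \<longleftrightarrow>
    (\<forall>a. rank E (Suc a) N + of_bool (Suc a \<in> J) \<le> rank E a N + of_bool (a \<in> J))"
proof -
  have E: "E \<subseteq> {(a, t). a < t \<and> t \<le> N}" "\<And>a t. rank E (Suc a) t \<le> rank E a t"
    using assms by (auto simp: histories_def)
  have sub: "add_level N E J \<subseteq> {(a, t). a < t \<and> t \<le> Suc N}"
    using assms(2) E(1) by (auto simp: add_level_def)
  have "(\<forall>t. rank (add_level N E J) (Suc a) t \<le> rank (add_level N E J) a t) \<longleftrightarrow>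
      rank (add_level N E J) (Suc a) (Suc N) \<le> rank (add_level N E J) a (Suc N)" for a
  proof (intro iffI allI)
    fix t
    assume *: "rank (add_level N E J) (Suc a) (Suc N) \<le> rank (add_level N E J) a (Suc N)"
    show "rank (add_level N E J) (Suc a) t \<le> rank (add_level N E J) a t"
    proof (cases "t \<le> N")
      case True
      then show ?thesis using E by (simp add: rank_add_level)
    next
      case False
      then have "Suc N \<le> t" by simp
      then show ?thesis using rank_beyond[OF sub] * by metis
    qed
  qed blast
  with sub show ?thesis
    by (simp add: histories_def rank_add_level[OF E(1)])
qed

lemma bij_betw_add_level:
  "bij_betw (\<lambda>(E, J). add_level N E J)
     {(E, J). E \<in> histories N \<and> J \<subseteq> {..N} \<and> add_level N E J \<in> histories (Suc N)}
     (histories (Suc N))"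
proof (rule bij_betw_byWitness[where f' = "\<lambda>E. ({(a, t) \<in> E. t \<le> N}, {a. (a, Suc N) \<in> E})"])
  show "\<forall>p\<in>{(E, J). E \<in> histories N \<and> J \<subseteq> {..N} \<and> add_level N E J \<in> histories (Suc N)}.
      ({(a, t) \<in> (\<lambda>(E, J). add_level N E J) p. t \<le> N},
       {a. (a, Suc N) \<in> (\<lambda>(E, J). add_level N E J) p}) = p"
    by (auto simp: add_level_def histories_def)
  have restrict: "{(a, t) \<in> E. t \<le> N} \<in> histories N \<and> {a. (a, Suc N) \<in> E} \<subseteq> {..N} \<and>
      add_level N {(a, t) \<in> E. t \<le> N} {a. (a, Suc N) \<in> E} = E" if "E \<in> histories (Suc N)" for E
  proof -
    have E: "E \<subseteq> {(a, t). a < t \<and> t \<le> Suc N}" "\<And>a t. rank E (Suc a) t \<le> rank E a t"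
      using that by (auto simp: histories_def)
    have sub: "{(a, t) \<in> E. t \<le> N} \<subseteq> {(a, t). a < t \<and> t \<le> N}" using E by auto
    have "rank {(a, t) \<in> E. t \<le> N} a t = rank E a (min t N)" for a t
      by (auto simp: rank_def intro: arg_cong[where f = card])
    with E sub have "{(a, t) \<in> E. t \<le> N} \<in> histories N"
      by (simp add: histories_def)
    moreover have "add_level N {(a, t) \<in> E. t \<le> N} {a. (a, Suc N) \<in> E} = E"
      using E(1) by (auto simp: add_level_def le_Suc_eq)
    ultimately show ?thesis using E(1) by auto
  qed
  then show "\<forall>E\<in>histories (Suc N). (\<lambda>(E, J). add_level N E J)
      ({(a, t) \<in> E. t \<le> N}, {a. (a, Suc N) \<in> E}) = E" by auto
  show "(\<lambda>(E, J). add_level N E J) `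
      {(E, J). E \<in> histories N \<and> J \<subseteq> {..N} \<and> add_level N E J \<in> histories (Suc N)} \<subseteq> histories (Suc N)"
    by auto
  show "(\<lambda>E. ({(a, t) \<in> E. t \<le> N}, {a. (a, Suc N) \<in> E})) ` histories (Suc N) \<subseteq>
      {(E, J). E \<in> histories N \<and> J \<subseteq> {..N} \<and> add_level N E J \<in> histories (Suc N)}"
    using restrict by auto
qed

text \<open>Generating polynomial of the final position of particle \<open>a\<close> without
  exclusion: \<open>N - Suc a\<close> places of drift, and an optional extra place at each time from
  its birth on.\<close>

definition particle_poly :: "(nat \<Rightarrow> 'a::comm_ring_1) \<Rightarrow> nat \<Rightarrow> nat \<Rightarrow> 'a poly" where
  "particle_poly w N a = monom 1 (N - Suc a) * (\<Prod>t\<in>{Suc a..N}. [:1, w t:])"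

lemma particle_poly_Suc:
  assumes "a < N"
  shows "particle_poly w (Suc N) a = monom 1 1 * [:1, w (Suc N):] * particle_poly w N a"
proof -
  have "monom 1 (Suc N - Suc a) = monom (1::'a) 1 * monom 1 (N - Suc a)"
    using assms by (simp add: mult_monom Suc_diff_Suc)
  moreover have "(\<Prod>t\<in>{Suc a..Suc N}. [:1, w t:]) = [:1, w (Suc N):] * (\<Prod>t\<in>{Suc a..N}. [:1, w t:])"
    using prod.nat_ivl_Suc'[of "Suc a" N "\<lambda>t. [:1, w t:]"] assms by simp
  ultimately show ?thesis
    unfolding particle_poly_def by (simp only: mult_ac)
qed

lemma particle_poly_last: "particle_poly w (Suc N) N = [:1, w (Suc N):]"
  by (simp add: particle_poly_def)

abbreviation state :: "nat \<Rightarrow> (nat \<times> nat) set \<Rightarrow> 'a::comm_ring_1 poly list" where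
  "state N E \<equiv> map (\<lambda>a. monom 1 (rank E a N + (N - Suc a))) [0..<N]"

text \<open>The form varies so that the induction can absorb the last time step into it.
  Multilinearity expands this step over all jump sets; those that violate exclusion make two
  adjacent vectors equal.\<close>

lemma sum_histories:
  assumes "alternating_form \<Phi>"
  shows "(\<Sum>E\<in>histories N. (\<Prod>(a, t)\<in>E. w t) * \<Phi> (state N E)) =
    \<Phi> (map (particle_poly w N) [0..<N])"
  using assms
proof (induction N arbitrary: \<Phi>)
  case 0
  have "histories 0 = {{}}" by (auto simp: histories_def rank_def)
  then show ?case by simp
next
  case (Suc N)
  let ?W = "\<lambda>E::(nat \<times> nat) set. \<Prod>(a, t)\<in>E. w t"
  let ?w = "w (Suc N)"
  let ?T = "\<lambda>p. monom 1 1 * [:1, ?w:] * p"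
  \<comment> \<open>Every old particle moves by \<open>?T\<close>, and the newborn one is appended:
    it starts at the origin and may jump at once.\<close>
  let ?\<Psi> = "\<lambda>ps. \<Phi> (map ?T ps @ [[:1, ?w:]])"
  have T: "?T (smult c x + y) = smult c (?T x) + ?T y" for c x y
    by (simp only: distrib_left mult_smult_right)
  have \<Psi>: "alternating_form ?\<Psi>"
    unfolding alternating_form_def map_append list.map T append_assoc append_Cons
    using alternating_form_linear[OF Suc.prems] alternating_form_adjacent[OF Suc.prems] by blast
  have step: "?\<Psi> (state N E) =
      (\<Sum>J\<in>Pow {..<Suc N}. ?w ^ card J * \<Phi> (state (Suc N) (add_level N E J)))"
    if "E \<in> histories N" for E
  proof -
    have E: "E \<subseteq> {(a, t). a < t \<and> t \<le> N}" using that by (auto simp: histories_def)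
    let ?p = "\<lambda>a. rank E a N + (N - a)"
    have moved: "map ?T (state N E) @ [[:1, ?w:]] =
        map (\<lambda>a. monom 1 (?p a) + smult ?w (monom 1 (Suc (?p a)))) [0..<Suc N]"
    proof -
      have "?T (monom 1 k) = monom 1 (Suc k) + smult ?w (monom 1 (Suc (Suc k)))" for k
        by (simp add: monom_Suc smult_monom)
      moreover have "Suc (rank E a N + (N - Suc a)) = ?p a" if "a < N" for a using that by simp
      ultimately have "?T (monom 1 (rank E a N + (N - Suc a))) =
          monom 1 (?p a) + smult ?w (monom 1 (Suc (?p a)))" if "a < N" for a
        using that by metis
      moreover have "[:1, ?w:] = monom 1 (?p N) + smult ?w (monom 1 (Suc (?p N)))"
        using rank_eq_0[OF E, of N N] by (simp add: monom_Suc monom_0)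
      ultimately show ?thesis by simp
    qed
    have "?\<Psi> (state N E) = (\<Sum>J\<in>Pow {..<Suc N}. ?w ^ card J * \<Phi> (map (\<lambda>a.
        if a \<in> J then monom 1 (Suc (?p a)) else monom 1 (?p a)) [0..<Suc N]))"
      using alternating_form_expand[OF Suc.prems, of "\<lambda>a. monom 1 (?p a)" ?w
          "\<lambda>a. monom 1 (Suc (?p a))" "Suc N" "[]"] unfolding moved append_Nil2 .
    also have "\<dots> = (\<Sum>J\<in>Pow {..<Suc N}. ?w ^ card J * \<Phi> (state (Suc N) (add_level N E J)))"
    proof -
      have "map (\<lambda>a. if a \<in> J then monom 1 (Suc (?p a)) else monom 1 (?p a)) [0..<Suc N] =
          (state (Suc N) (add_level N E J) :: 'a poly list)" for J
        by (rule map_cong[OF refl]) (simp add: rank_add_level[OF E])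
      then show ?thesis by (simp only:)
    qed
    finally show ?thesis .
  qed
  have vanish: "\<Phi> (state (Suc N) (add_level N E J)) = 0"
    if EJ: "E \<in> histories N" "J \<subseteq> {..N}" and outside: "add_level N E J \<notin> histories (Suc N)" for E J
  proof -
    have E: "E \<subseteq> {(a, t). a < t \<and> t \<le> N}" "\<And>a t. rank E (Suc a) t \<le> rank E a t"
      using EJ by (auto simp: histories_def)
    obtain a where a: "rank E (Suc a) N + of_bool (Suc a \<in> J) > rank E a N + of_bool (a \<in> J)"
      using outside unfolding add_level_in_histories_iff[OF EJ] not_all not_le by blast
    \<comment> \<open>A rank grows by at most one, so a violation needs neighbours of equal rank of
      which only \<open>Suc a\<close> jumps; it then lands on the place of \<open>a\<close>.\<close>
    with E(2)[of a N] have a': "rank E (Suc a) N = rank E a N" "Suc a \<in> J" "a \<notin> J"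
      by (auto simp: of_bool_def split: if_splits)
    with EJ have aN: "Suc a \<le> N" by auto
    let ?q = "\<lambda>a. monom 1 (rank (add_level N E J) a (Suc N) + (Suc N - Suc a)) :: 'a poly"
    have "[0..<Suc N] = [0..<a] @ a # Suc a # [Suc (Suc a)..<Suc N]"
      using aN upt_add_eq_append[of 0 a "Suc N - a"] by (simp add: upt_conv_Cons del: upt_Suc)
    then have "state (Suc N) (add_level N E J) =
        map ?q [0..<a] @ ?q a # ?q (Suc a) # map ?q [Suc (Suc a)..<Suc N]" by simp
    moreover have "?q (Suc a) = ?q a"
      using a' aN by (simp add: rank_add_level[OF E(1)] Suc_diff_Suc)
    ultimately show ?thesis using alternating_form_adjacent[OF Suc.prems] by simp
  qed
  have W: "?W (add_level N E J) = ?W E * ?w ^ card J"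
    if "E \<in> histories N" "J \<subseteq> {..N}" for E J
  proof -
    have E: "E \<subseteq> {(a, t). a < t \<and> t \<le> N}" using that by (auto simp: histories_def)
    then have "finite E" "finite J"
      using that by (auto intro: finite_subset finite_triangle)
    then have "?W (add_level N E J) = ?W E * ?W (J \<times> {Suc N})"
      unfolding add_level_def using E by (intro prod.union_disjoint) auto
    also have "?W (J \<times> {Suc N}) = ?w ^ card J"
      by (subst prod.cartesian_product[symmetric]) simp
    finally show ?thesis .
  qed
  let ?A = "{(E, J). E \<in> histories N \<and> J \<subseteq> {..N} \<and> add_level N E J \<in> histories (Suc N)}"
  have "(\<Sum>E\<in>histories (Suc N). ?W E * \<Phi> (state (Suc N) E)) =
      (\<Sum>(E, J)\<in>?A. ?W (add_level N E J) * \<Phi> (state (Suc N) (add_level N E J)))"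
    by (subst sum.reindex_bij_betw[OF bij_betw_add_level, symmetric]) (simp add: split_def)
  \<comment> \<open>By \<open>vanish\<close>, the inadmissible jump sets can be included at no
    cost.\<close>
  also have "\<dots> = (\<Sum>(E, J)\<in>histories N \<times> Pow {..<Suc N}.
      ?W (add_level N E J) * \<Phi> (state (Suc N) (add_level N E J)))"
  proof (rule sum.mono_neutral_left)
    show "finite (histories N \<times> Pow {..<Suc N})" by (simp add: finite_histories)
    show "?A \<subseteq> histories N \<times> Pow {..<Suc N}" by (auto simp: lessThan_Suc_atMost)
    show "\<forall>p\<in>histories N \<times> Pow {..<Suc N} - ?A.
        (case p of (E, J) \<Rightarrow> ?W (add_level N E J) * \<Phi> (state (Suc N) (add_level N E J))) = 0"
    proof
      fix p assume p: "p \<in> histories N \<times> Pow {..<Suc N} - ?A"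
      obtain E J where EJ: "p = (E, J)" by (cases p)
      with p have "\<Phi> (state (Suc N) (add_level N E J)) = 0"
        by (intro vanish) (auto simp: lessThan_Suc_atMost)
      then show "(case p of (E, J) \<Rightarrow> ?W (add_level N E J) * \<Phi> (state (Suc N) (add_level N E J))) = 0"
        by (simp only: EJ prod.case mult_zero_right)
    qed
  qed
  also have "\<dots> = (\<Sum>E\<in>histories N. \<Sum>J\<in>Pow {..<Suc N}.
      ?W (add_level N E J) * \<Phi> (state (Suc N) (add_level N E J)))"
    by (rule sum.cartesian_product[symmetric])
  also have "\<dots> = (\<Sum>E\<in>histories N. ?W E * ?\<Psi> (state N E))"
  proof (rule sum.cong[OF refl])
    fix E assume E: "E \<in> histories N"
    show "(\<Sum>J\<in>Pow {..<Suc N}. ?W (add_level N E J) * \<Phi> (state (Suc N) (add_level N E J))) =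
        ?W E * ?\<Psi> (state N E)"
      unfolding step[OF E] sum_distrib_left
      by (intro sum.cong refl) (simp only: W[OF E] Pow_iff lessThan_Suc_atMost mult.assoc)
  qed
  also have "\<dots> = ?\<Psi> (map (particle_poly w N) [0..<N])"
    by (rule Suc.IH[OF \<Psi>])
  also have "\<dots> = \<Phi> (map (particle_poly w (Suc N)) [0..<Suc N])"
  proof -
    have "map ?T (map (particle_poly w N) [0..<N]) = map (particle_poly w (Suc N)) [0..<N]"
      unfolding map_map by (rule map_cong) (simp_all only: comp_def particle_poly_Suc atLeastLessThan_iff set_upt)
    then show ?thesis by (simp only: upt_Suc_append le0 map_append list.map particle_poly_last)
  qed
  finally show ?case .
qed

subsection \<open>Pivots of the Mills-Robbins-Rumsey matrix\<close>

text \<open>With the reciprocal factorial extended by \<open>0\<close> to negative integers, the contiguity relations of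
  the summand hold without boundary cases.\<close>

definition rfact :: "int \<Rightarrow> rat" where
  "rfact z = (if z < 0 then 0 else 1 / fact (nat z))"

lemma rfact_diff_1: "rfact (z - 1) = of_int z * rfact z"
proof (cases "z \<le> 0")
  case False
  then have "nat z = Suc (nat (z - 1))" by simp
  moreover have "rat_of_nat (Suc (nat (z - 1))) = of_int z" using False by simp
  ultimately have "fact (nat z) = of_int z * (fact (nat (z - 1)) :: rat)"
    by (metis fact_Suc of_nat_fact of_nat_mult)
  with False show ?thesis by (simp add: rfact_def)
qed (auto simp: rfact_def)

lemma rfact_pred: "z' = z - 1 \<Longrightarrow> rfact z' = of_int z * rfact z"
  using rfact_diff_1 by simp

definition entry :: "nat \<Rightarrow> nat \<Rightarrow> rat" where
  "entry j i = fact (i + j + 1) * rfact (2 * int i - int j) * rfact (2 * int j + 1 - int i)"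

text \<open>For \<open>i > 2 * j + 1\<close> the lower index exceeds the upper one, and the binomial
  vanishes together with the last reciprocal factorial.\<close>

lemma entry_eq_binomial:
  "entry j i = (if j \<le> 2 * i then of_nat ((i + j + 1) choose (2 * i - j)) else 0)"
proof (cases "j \<le> 2 * i \<and> i \<le> 2 * j + 1")
  case True
  then have "nat (2 * int i - int j) = 2 * i - j" "nat (2 * int j + 1 - int i) = 2 * j + 1 - i"
    "(i + j + 1) - (2 * i - j) = 2 * j + 1 - i" by auto
  moreover have "2 * i - j \<le> i + j + 1" using True by auto
  ultimately show ?thesis
    using True unfolding entry_def rfact_def by (simp only: binomial_fact) auto
qed (auto simp: entry_def rfact_def)

text \<open>Coefficients of the triangular change of basis, given by their successive ratios. The
  numerator at \<open>l = k\<close> cuts them off after \<open>i = k\<close>.\<close>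

definition kernel :: "nat \<Rightarrow> nat \<Rightarrow> rat" where
  "kernel k i = (\<Prod>l<i. - ((2 * of_nat k - 2 * of_nat l) * (2 * of_nat k + 2 * of_nat l + 3)) /
     ((2 * of_nat k - of_nat l) * (2 * of_nat k + of_nat l + 3)))"

lemma kernel_Suc:
  assumes "i \<le> k"
  shows "(2 * of_nat k - of_nat i) * (2 * of_nat k + of_nat i + 3) * kernel k (Suc i) =
    - ((2 * of_nat k - 2 * of_nat i) * (2 * of_nat k + 2 * of_nat i + 3)) * kernel k i"
\<comment> \<open>For \<open>k = 0\<close> the ratio has a zero denominator at the only index
  \<open>i = 0\<close>, but both sides of the cleared relation vanish.\<close>
proof (cases "k = 0")
  case False
  with assms have "2 * rat_of_nat k - of_nat i \<noteq> 0"
    by (metis diff_is_0_eq eq_iff_diff_eq_0 less_le_not_le mult_2 not_add_less1 of_nat_add of_nat_eq_iff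
        add_le_same_cancel1 add_leD1 le_antisym le_zero_eq)
  moreover have "2 * rat_of_nat k + of_nat i + 3 > 0"
    by (simp add: add_nonneg_pos)
  ultimately show ?thesis by (simp add: kernel_def)
qed (use assms in simp)

lemma kernel_nonzero: "i \<le> k \<Longrightarrow> kernel k i \<noteq> 0"
proof (induction i)
  case (Suc i)
  have "2 * rat_of_nat k + 2 * of_nat i + 3 > 0" by (simp add: add_nonneg_pos)
  with Suc kernel_Suc[of i k] show ?case by auto
qed (simp add: kernel_def)

section \<open>Elimination by creative telescoping\<close>

definition residual :: "nat \<Rightarrow> nat \<Rightarrow> rat" where
  "residual k j = (\<Sum>i\<le>k. kernel k i * entry j i)"

text \<open>The recurrence holds for the summands up to a difference \<open>G (Suc i) - G i\<close>,
  and \<open>G\<close> vanishes at both ends.\<close>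

lemma residual_rec:
  "2 * (of_nat j + 1 - of_nat k) * (2 * of_nat j + 2 * of_nat k + 5) * residual k (Suc j) =
   (2 * of_nat k - of_nat j) * (of_nat j + 2 * of_nat k + 3) * residual k j"
proof -
  \<comment> \<open>Each reciprocal factorial is taken at the larger of its arguments in rows
    \<open>j\<close> and \<open>Suc j\<close>, so that both entries become polynomial multiples of
    \<open>h i\<close>.\<close>
  define h where "h i = fact (i + j + 1) * rfact (2 * int i - int j) * rfact (2 * int j + 3 - int i)" for i
  \<comment> \<open>The Wilf-Zeilberger certificate of the recurrence.\<close>
  define G where "G i = kernel k i * h i * (2 * of_nat i - of_nat j - 1) * (2 * of_nat i - of_nat j) *
    (2 * of_nat k - of_nat i + 1) * (2 * of_nat k + of_nat i + 2)" for i
  have e0: "entry j i = h i * (2 * of_nat j + 3 - of_nat i) * (2 * of_nat j + 2 - of_nat i)" for i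
  proof -
    have "rfact (2 * int j + 1 - int i) =
        (2 * of_nat j + 2 - of_nat i) * ((2 * of_nat j + 3 - of_nat i) * rfact (2 * int j + 3 - int i))"
      using rfact_pred[of "2 * int j + 1 - int i" "2 * int j + 2 - int i"]
        rfact_pred[of "2 * int j + 2 - int i" "2 * int j + 3 - int i"] by simp
    then show ?thesis by (simp add: entry_def h_def)
  qed
  have e1: "entry (Suc j) i = h i * (of_nat i + of_nat j + 2) * (2 * of_nat i - of_nat j)" for i
  proof -
    have "rfact (2 * int i - int (Suc j)) = (2 * of_nat i - of_nat j) * rfact (2 * int i - int j)"
      using rfact_diff_1[of "2 * int i - int j"] by (simp add: algebra_simps)
    moreover have "rfact (2 * int (Suc j) + 1 - int i) = rfact (2 * int j + 3 - int i)"
      by (simp add: algebra_simps)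
    moreover have "(fact (i + Suc j + 1) :: rat) = (of_nat i + of_nat j + 2) * fact (i + j + 1)"
      by (simp add: algebra_simps)
    ultimately show ?thesis by (simp add: entry_def h_def)
  qed
  have e2: "h (Suc i) * (2 * of_nat i + 1 - of_nat j) * (2 * of_nat i + 2 - of_nat j) =
      h i * (of_nat i + of_nat j + 2) * (2 * of_nat j + 3 - of_nat i)" for i
  proof -
    have "rfact (2 * int i - int j) =
        (2 * of_nat i + 1 - of_nat j) * ((2 * of_nat i + 2 - of_nat j) * rfact (2 * int (Suc i) - int j))"
      using rfact_pred[of "2 * int i - int j" "2 * int i + 1 - int j"]
        rfact_pred[of "2 * int i + 1 - int j" "2 * int (Suc i) - int j"] by simp
    moreover have "rfact (2 * int j + 3 - int (Suc i)) =
        (2 * of_nat j + 3 - of_nat i) * rfact (2 * int j + 3 - int i)"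
      using rfact_diff_1[of "2 * int j + 3 - int i"] by (simp add: algebra_simps)
    moreover have "(fact (Suc i + j + 1) :: rat) = (of_nat i + of_nat j + 2) * fact (i + j + 1)"
      by (simp add: algebra_simps)
    ultimately show ?thesis by (simp add: h_def)
  qed
  have telescope: "2 * (of_nat j + 1 - of_nat k) * (2 * of_nat j + 2 * of_nat k + 5) *
        (kernel k i * entry (Suc j) i) -
      (2 * of_nat k - of_nat j) * (of_nat j + 2 * of_nat k + 3) * (kernel k i * entry j i) =
      G (Suc i) - G i" if "i \<le> k" for i
  proof -
    have "G (Suc i) = ((2 * of_nat k - of_nat i) * (2 * of_nat k + of_nat i + 3) * kernel k (Suc i)) *
        (h (Suc i) * (2 * of_nat i + 1 - of_nat j) * (2 * of_nat i + 2 - of_nat j))"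
      by (simp add: G_def algebra_simps)
    also have "\<dots> = - ((2 * of_nat k - 2 * of_nat i) * (2 * of_nat k + 2 * of_nat i + 3)) * kernel k i *
        (h i * (of_nat i + of_nat j + 2) * (2 * of_nat j + 3 - of_nat i))"
      unfolding kernel_Suc[OF that] e2 ..
    finally show ?thesis unfolding e0 e1 G_def by algebra
  qed
  \<comment> \<open>The factor \<open>l = k\<close> is zero. At the other end, \<open>G 0\<close>
    contains the factor \<open>- j\<close>, and for positive \<open>j\<close> a reciprocal factorial
    of a negative number.\<close>
  have "kernel k (Suc k) = 0" by (auto simp: kernel_def)
  then have "G (Suc k) = 0" by (simp add: G_def)
  moreover have "G 0 = 0" by (cases "j = 0") (auto simp: G_def h_def rfact_def)
  moreover have "(\<Sum>i\<le>k. G (Suc i) - G i) = G (Suc k) - G 0"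
    by (induction k) (use sum_lessThan_telescope in auto)
  ultimately have "(\<Sum>i\<le>k. G (Suc i) - G i) = 0" by simp
  then show ?thesis
    unfolding residual_def by (simp add: sum_distrib_left telescope[symmetric] sum_subtractf)
qed

text \<open>Downward induction on the row: the left coefficient of \<open>residual_rec\<close>
  vanishes at \<open>Suc j = k\<close>, which starts the induction, and the right one is nonzero for
  \<open>j < k\<close>.\<close>

lemma residual_below: "j < k \<Longrightarrow> residual k j = 0"
proof (induction "k - j" arbitrary: j)
  case (Suc n)
  have "2 * rat_of_nat k - of_nat j > 0" using Suc.prems
    by (metis diff_gt_0_iff_gt mult_2 of_nat_add of_nat_less_iff trans_less_add1)
  moreover have "rat_of_nat j + 2 * of_nat k + 3 > 0" by (simp add: add_nonneg_pos)
  moreover have "2 * (of_nat j + 1 - of_nat k) * (2 * of_nat j + 2 * of_nat k + 5) * residual k (Suc j) = 0"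
  proof (cases "Suc j = k")
    case True
    then have "of_nat j + 1 - rat_of_nat k = 0" by auto
    then show ?thesis by simp
  qed (use Suc in simp)
  ultimately show ?case unfolding residual_rec[of j k] by auto
qed simp

text \<open>In row \<open>2 * k\<close> the columns \<open>i < k\<close> lie outside the support of
  the matrix. This is the known value from which the recurrence is run down to the diagonal.\<close>

lemma residual_top: "residual k (2 * k) = kernel k k"
proof -
  have "residual k (2 * k) = (\<Sum>i\<in>{k}. kernel k i * entry (2 * k) i)"
    unfolding residual_def by (rule sum.mono_neutral_right) (auto simp: entry_eq_binomial)
  then show ?thesis by (simp add: entry_eq_binomial)
qed

definition pivot :: "nat \<Rightarrow> rat" where
  "pivot k = fact (6 * k + 4) * fact (2 * k + 2) / (fact (4 * k + 4) * fact (4 * k + 2))"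

text \<open>The recurrence iterated down from row \<open>2 * k\<close>, with denominators cleared.
  The odd factors \<open>6 * k + 3 - 2 * t\<close> are completed to a factorial by the even ones
  \<open>6 * k + 4 - 2 * t\<close>, twice \<open>3 * k + 2 - t\<close>; hence
  \<open>fact (3 * k + 2 - t)\<close>.\<close>

lemma residual_descend:
  "t \<le> k \<Longrightarrow> residual k (2 * k - t) * (fact t * fact (k - t) * fact (6 * k + 4 - 2 * t) *
      fact (3 * k + 2) * fact (4 * k + 2)) =
    kernel k k * (fact k * fact (6 * k + 4) * fact (3 * k + 2 - t) * fact (4 * k + 2 - t))"
proof (induction t)
  case 0
  then show ?case by (simp add: residual_top)
next
  case (Suc t)
  define K T :: rat where "K = of_nat k" and "T = of_nat t"
  have TK: "T + 1 \<le> K" using of_nat_mono[OF Suc.prems, where 'a = rat] by (simp add: K_def T_def)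
  have "T \<ge> 0" by (simp add: T_def)
  have "2 * k - t = Suc (2 * k - Suc t)" using Suc.prems by simp
  moreover have "rat_of_nat (2 * k - Suc t) = 2 * K - T - 1"
    using Suc.prems by (simp add: of_nat_diff K_def T_def)
  ultimately have rec: "2 * (K - T) * (6 * K + 3 - 2 * T) * residual k (2 * k - t) =
      (T + 1) * (4 * K + 2 - T) * residual k (2 * k - Suc t)"
    using residual_rec[of "2 * k - Suc t" k] by (simp add: algebra_simps flip: K_def T_def)
  have f1: "(fact (Suc t) :: rat) = (T + 1) * fact t" by (simp add: T_def)
  have f2: "(fact (k - t) :: rat) = (K - T) * fact (k - Suc t)"
    using Suc.prems by (simp add: Suc_diff_Suc[symmetric] of_nat_diff K_def T_def)
  have "6 * k + 4 - 2 * t = Suc (Suc (6 * k + 4 - 2 * Suc t))" using Suc.prems by simp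
  moreover have "rat_of_nat (6 * k + 4 - 2 * Suc t) = 6 * K + 2 - 2 * T"
    using Suc.prems by (simp add: of_nat_diff K_def T_def)
  ultimately have f3: "(fact (6 * k + 4 - 2 * t) :: rat) =
      (6 * K + 4 - 2 * T) * (6 * K + 3 - 2 * T) * fact (6 * k + 4 - 2 * Suc t)"
    by (simp only: fact_Suc of_nat_mult of_nat_Suc of_nat_fact) (simp add: algebra_simps)
  have "3 * k + 2 - t = Suc (3 * k + 2 - Suc t)" using Suc.prems by simp
  moreover have "rat_of_nat (3 * k + 2 - Suc t) = 3 * K + 1 - T"
    using Suc.prems by (simp add: of_nat_diff K_def T_def)
  ultimately have f4: "(fact (3 * k + 2 - t) :: rat) = (3 * K + 2 - T) * fact (3 * k + 2 - Suc t)"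
    by (simp only: fact_Suc of_nat_mult of_nat_Suc of_nat_fact) (simp add: algebra_simps)
  have "4 * k + 2 - t = Suc (4 * k + 2 - Suc t)" using Suc.prems by simp
  moreover have "rat_of_nat (4 * k + 2 - Suc t) = 4 * K + 1 - T"
    using Suc.prems by (simp add: of_nat_diff K_def T_def)
  ultimately have f5: "(fact (4 * k + 2 - t) :: rat) = (4 * K + 2 - T) * fact (4 * k + 2 - Suc t)"
    by (simp only: fact_Suc of_nat_mult of_nat_Suc of_nat_fact) (simp add: algebra_simps)
  \<comment> \<open>The claim is first proved times the two factors split off in \<open>f4\<close>
    and \<open>f5\<close>, which are nonzero by \<open>TK\<close>.\<close>
  have "(3 * K + 2 - T) * (4 * K + 2 - T) *
      (residual k (2 * k - Suc t) * ((T + 1) * fact t * fact (k - Suc t) *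
       fact (6 * k + 4 - 2 * Suc t) * fact (3 * k + 2) * fact (4 * k + 2))) =
    (3 * K + 2 - T) * (4 * K + 2 - T) *
      (kernel k k * (fact k * fact (6 * k + 4) * fact (3 * k + 2 - Suc t) * fact (4 * k + 2 - Suc t)))"
    using Suc.IH Suc.prems rec unfolding f2 f3 f4 f5 by (simp only: Suc_leD) algebra
  moreover have "3 * K + 2 - T \<noteq> 0" "4 * K + 2 - T \<noteq> 0" using TK \<open>T \<ge> 0\<close> by linarith+
  ultimately show ?case unfolding f1 by simp
qed

lemma residual_diag: "residual k k = kernel k k * pivot k"
proof -
  have "6 * k + 4 - 2 * k = 4 * k + 4" "3 * k + 2 - k = 2 * k + 2" "4 * k + 2 - k = 3 * k + 2"
    "2 * k - k = k" by auto
  note descend = residual_descend[of k k, unfolded this, OF order_refl, unfolded diff_self_eq_0 fact_0]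
  have cancel: "r = c * (e * f / (b * d))"
    if "r * (a * 1 * b * g * d) = c * (a * e * f * g)" "a \<noteq> 0" "b \<noteq> 0" "d \<noteq> 0" "g \<noteq> 0"
    for a b c d e f g r :: rat
    using that by (simp add: field_simps)
  show ?thesis unfolding pivot_def by (rule cancel[OF descend]) simp_all
qed

text \<open>Passing to \<open>Suc m\<close> changes every denominator. The correction quotients
  telescope, and together with the new factor they give \<open>pivot m\<close>.\<close>

lemma prod_pivot:
  "(\<Prod>k<m. pivot k) = (\<Prod>k = 1..m. fact (6 * k - 2) / fact (2 * k + 2 * m))"
proof (induction m)
  case (Suc m)
  have telescope: "(\<Prod>k = 1..m. fact (2 * k + 2 * m) / fact (2 * k + 2 * Suc m) :: rat) =
      fact (2 * m + 2) / fact (4 * m + 2)"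
  proof -
    have "(\<Prod>k = 1..n. fact (2 * k + 2 * m) / fact (2 * k + 2 * Suc m) :: rat) =
      fact (2 * m + 2) / fact (2 * n + 2 * m + 2)" for n
      by (induction n) (simp_all add: divide_simps)
    from this[of m] show ?thesis by simp
  qed
  let ?f = "\<lambda>k. fact (6 * k - 2) / fact (2 * k + 2 * Suc m) :: rat"
  have "(\<Prod>k = 1..m. ?f k) = (\<Prod>k = 1..m. (fact (6 * k - 2) / fact (2 * k + 2 * m)) *
      (fact (2 * k + 2 * m) / fact (2 * k + 2 * Suc m)))"
    by (intro prod.cong refl) simp
  also have "\<dots> = (\<Prod>k<m. pivot k) * (fact (2 * m + 2) / fact (4 * m + 2))"
    by (simp only: prod.distrib Suc.IH telescope)
  finally have "(\<Prod>k = 1..m. ?f k) = (\<Prod>k<m. pivot k) * (fact (2 * m + 2) / fact (4 * m + 2))" .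
  moreover have "(\<Prod>k = 1..Suc m. ?f k) = (\<Prod>k = 1..m. ?f k) * ?f (Suc m)"
    by (subst prod.nat_ivl_Suc') (simp_all only: mult.commute le_add2 Suc_eq_plus1)
  moreover have "?f (Suc m) = fact (6 * m + 4) / fact (4 * m + 4)"
  proof -
    have "6 * Suc m - 2 = 6 * m + 4" "2 * Suc m + 2 * Suc m = 4 * m + 4" by auto
    then show ?thesis by presburger
  qed
  moreover have "pivot m = fact (2 * m + 2) / fact (4 * m + 2) * (fact (6 * m + 4) / fact (4 * m + 4))"
    by (simp only: pivot_def times_divide_times_eq mult_ac)
  ultimately show ?case by (simp only: prod.lessThan_Suc mult_ac)
qed simp

subsection \<open>The signed count of histories\<close>

definition prefix_sum :: "'a::comm_ring_1 poly \<Rightarrow> nat \<Rightarrow> 'a" where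
  "prefix_sum p r = (\<Sum>s<r. coeff p s)"

text \<open>The form with value \<open>1\<close> on monomials of degrees \<open>p > q\<close>, cut
  off at degree \<open>B\<close> to be a finite sum; the prefix sums collect all
  \<open>q < p\<close>.\<close>

definition pairing :: "nat \<Rightarrow> 'a::comm_ring_1 poly \<Rightarrow> 'a poly \<Rightarrow> 'a" where
  "pairing B p q = (\<Sum>r<B. coeff p r * prefix_sum q r - coeff q r * prefix_sum p r)"

interpretation pairing: alternating_pairing "pairing B"
proof
  have prefix: "prefix_sum (smult c x + y) r = c * prefix_sum x r + prefix_sum y r" for c :: 'a and x y r
    by (simp add: prefix_sum_def sum.distrib sum_distrib_left)
  show "pairing B (smult c x + y) z = c * pairing B x z + pairing B y z" for c :: 'a and x y z
    unfolding pairing_def prefix sum_distrib_left sum.distrib[symmetric]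
    by (intro sum.cong refl) (simp add: algebra_simps)
  show "pairing B z (smult c x + y) = c * pairing B z x + pairing B z y" for c :: 'a and x y z
    unfolding pairing_def prefix sum_distrib_left sum.distrib[symmetric]
    by (intro sum.cong refl) (simp add: algebra_simps)
  show "pairing B x x = 0" for x :: "'a poly" by (simp add: pairing_def)
qed

lemma pairing_commute: "pairing B p q = - pairing B q p"
  by (simp add: pairing_def sum_negf[symmetric])

lemma prefix_sum_monom: "prefix_sum (monom c k) r = (if k < r then c else 0)"
  by (simp add: prefix_sum_def sum.delta)

text \<open>All coefficients of \<open>q\<close> lie below position \<open>k\<close>, so the prefix
  sum there is the full coefficient sum.\<close>

lemma pairing_monom:
  assumes "k < B" "degree q < k"
  shows "pairing B (monom 1 k) q = poly q 1"
proof -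
  have "coeff (monom 1 k) r * prefix_sum q r - coeff q r * prefix_sum (monom 1 k) r =
      (if r = k then poly q 1 else 0)" for r
  proof (cases "r = k")
    case True
    have "prefix_sum q k = (\<Sum>s\<le>degree q. coeff q s)"
      unfolding prefix_sum_def by (rule sum.mono_neutral_right) (use assms in \<open>auto simp: coeff_eq_0\<close>)
    with True show ?thesis by (simp add: prefix_sum_monom poly_altdef)
  qed (use assms in \<open>auto simp: prefix_sum_monom coeff_eq_0\<close>)
  with assms show ?thesis by (simp add: pairing_def)
qed

lemma sum_lessThan_double:
  fixes f :: "nat \<Rightarrow> 'a::comm_monoid_add"
  shows "(\<Sum>r<2 * b. f r) = (\<Sum>k<b. f (2 * k) + f (Suc (2 * k)))"
  by (induction b) (simp_all add: add.assoc)

text \<open>Exclusion makes the positions strictly decrease along the list, and all of them are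
  below \<open>2 * N\<close>, hence inside the truncation.\<close>

lemma pairing_state:
  assumes "E \<in> histories N" "i < j" "j < N" "2 * N \<le> B"
  shows "pairing B (state N E ! i) (state N E ! j) = (1 :: 'a::comm_ring_1)"
proof -
  have antimono: "rank E j N \<le> rank E i N"
    using lift_Suc_antimono_le[of "\<lambda>a. rank E a N"] assms(1,2) by (auto simp: histories_def)
  moreover have "rank E i N \<le> N - i" by (rule rank_le[OF histories_subset[OF assms(1)]])
  ultimately show ?thesis
    using assms by (subst nth_map; simp) (subst pairing_monom; simp add: degree_monom_eq poly_monom)
qed

lemma degree_particle_poly: "degree (particle_poly w N a) \<le> N - Suc a + (N - a)"
proof -
  have "degree (particle_poly w N a) \<le> degree (monom (1::'a) (N - Suc a)) +
      degree (\<Prod>t\<in>{Suc a..N}. [:1, w t:])"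
    unfolding particle_poly_def by (rule degree_mult_le)
  also have "degree (\<Prod>t\<in>{Suc a..N}. [:1, w t:]) \<le> (\<Sum>t\<in>{Suc a..N}. degree [:1, w t:])"
    using degree_prod_sum_le[of "{Suc a..N}" "\<lambda>t. [:1, w t:]"] by (simp add: comp_def)
  also have "\<dots> \<le> (\<Sum>t\<in>{Suc a..N}. 1)" by (rule sum_mono) (simp add: degree_pCons_le)
  finally show ?thesis by (simp add: degree_monom_eq)
qed

text \<open>To obtain a list of even length, \<open>monom 1 (2 * N)\<close> is put in front; it lies
  above all positions. It pairs with each particle polynomial to the value at \<open>1\<close>,
  which vanishes by the factor \<open>1 - x\<close> of time \<open>N\<close>.\<close>

lemma sum_histories_odd:
  assumes "odd N" "w N = (- 1 :: 'a::comm_ring_1)"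
  shows "(\<Sum>E\<in>histories N. \<Prod>(a, t)\<in>E. w t) = 0"
proof -
  \<comment> \<open>One more than \<open>2 * N\<close>, to keep the added monomial inside the
    truncation.\<close>
  let ?B = "Suc (2 * N)"
  let ?\<Phi> = "\<lambda>ps. pfaffian (pairing ?B) (monom 1 (2 * N) # ps) :: 'a"
  have \<Phi>: "alternating_form ?\<Phi>"
    using pairing.alternating_form_pfaffian[of ?B] unfolding alternating_form_def
    by (metis append_Cons)
  have one: "?\<Phi> (state N E) = 1" if E: "E \<in> histories N" for E
  proof (rule pfaffian_ones)
    fix i j assume ij: "i < j" "j < length (monom 1 (2 * N) # state N E :: 'a poly list)"
    obtain j' where j': "j = Suc j'" "j' < N" using ij by (cases j) auto
    show "pairing ?B ((monom 1 (2 * N) # state N E) ! i) ((monom 1 (2 * N) # state N E) ! j) = (1 :: 'a)"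
    proof (cases i)
      case 0
      have "rank E j' N + (N - Suc j') < 2 * N" using rank_le[OF histories_subset[OF E], of j' N] j'(2) by simp
      then show ?thesis
        using 0 j' by (simp add: pairing_monom degree_monom_eq poly_monom)
    next
      case (Suc i')
      then show ?thesis using pairing_state[OF E, of i' j' ?B] ij j' by simp
    qed
  qed (use assms in auto)
  have zero: "pairing ?B (monom 1 (2 * N)) (particle_poly w N a) = 0" if "a < N" for a
  proof -
    have "degree (particle_poly w N a) < 2 * N"
      using degree_particle_poly[of w N a] that by simp
    moreover have "poly (particle_poly w N a) 1 = 0"
      unfolding particle_poly_def poly_mult poly_prod using assms(2) that
      by (simp add: prod.remove[of _ N])
    ultimately show ?thesis by (simp add: pairing_monom)
  qed
  have "(\<Sum>E\<in>histories N. \<Prod>(a, t)\<in>E. w t) = (\<Sum>E\<in>histories N. (\<Prod>(a, t)\<in>E. w t) * ?\<Phi> (state N E))"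
    by (intro sum.cong refl) (simp only: one mult_1_right)
  also have "\<dots> = ?\<Phi> (map (particle_poly w N) [0..<N])"
    by (rule sum_histories[OF \<Phi>])
  also have "\<dots> = 0" by (simp add: zero)
  finally show ?thesis .
qed

lemma sum_histories_even:
  assumes "even N" "2 * N \<le> B"
  shows "(\<Sum>E\<in>histories N. \<Prod>(a, t)\<in>E. w t) =
    pfaffian (pairing B) (map (particle_poly w N) [0..<N])"
proof -
  have "pfaffian (pairing B) (state N E :: 'a poly list) = 1" if "E \<in> histories N" for E
    by (rule pfaffian_ones) (use assms pairing_state[OF that] in auto)
  then show ?thesis
    using sum_histories[OF pairing.alternating_form_pfaffian[of B], where N = N and w = w] by simp
qed

text \<open>Particle polynomials renumbered from the last born. The sign of a jump depends only on
  its distance from the final time, so \<open>N\<close> disappears.\<close>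

definition step_poly :: "nat \<Rightarrow> rat poly" where
  "step_poly i = monom 1 i * (\<Prod>s\<in>{1..Suc i}. [:1, (- 1) ^ s:])"

lemma particle_poly_eq_step_poly:
  assumes "a < N"
  shows "particle_poly (\<lambda>t. (- 1) ^ (Suc N - t)) N a = step_poly (N - Suc a)"
proof -
  have "(\<Prod>t\<in>{Suc a..N}. [:1, (- 1) ^ (Suc N - t):]) = (\<Prod>s\<in>{1..Suc (N - Suc a)}. [:1, (- 1) ^ s :: rat:])"
    by (rule prod.reindex_bij_witness[where i = "\<lambda>s. Suc N - s" and j = "\<lambda>t. Suc N - t"])
      (use assms in auto)
  then show ?thesis by (simp add: particle_poly_def step_poly_def)
qed

lemma map_particle_poly:
  "map (particle_poly (\<lambda>t. (- 1) ^ (Suc N - t)) N) [0..<N] = map step_poly (rev [0..<N])"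
  by (rule nth_equalityI) (simp_all add: particle_poly_eq_step_poly rev_nth)

section \<open>Pairings of step polynomials, split by parity of the index\<close>

definition base_poly :: "nat \<Rightarrow> rat poly" where
  "base_poly i = monom 1 i * [:1, - 1:] ^ i"

abbreviation at_square :: "'a::comm_ring_1 poly \<Rightarrow> 'a poly" where
  "at_square p \<equiv> pcompose p [:0, 0, 1:]"

lemma coeff_at_square: "coeff (at_square p) n = (if even n then coeff p (n div 2) else 0)"
proof (induction p arbitrary: n)
  case (pCons c p)
  have at_square: "at_square (pCons c p) = pCons c (pCons 0 (at_square p))"
    by (simp add: pcompose_pCons)
  show ?case
  proof (cases n)
    case (Suc m)
    then show ?thesis
      unfolding at_square using pCons.IH[of "m - 1"] by (cases m) auto
  qed (simp add: at_square)
qed simp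

lemma at_square_power: "at_square (p ^ n) = at_square p ^ n"
  by (induction n) (simp_all add: pcompose_mult pcompose_1)

lemma at_square_monom: "at_square (monom c n) = monom c (2 * n)"
  by (induction n) (simp_all add: monom_0 monom_Suc pcompose_pCons)

lemma at_square_base_poly: "at_square (base_poly i) = monom 1 (2 * i) * [:1, 0, - 1:] ^ i"
  by (simp add: base_poly_def pcompose_mult at_square_power at_square_monom) (simp add: pcompose_pCons)

text \<open>Two consecutive factors combine to \<open>1 - x^2\<close>, which reduces the step
  polynomials to polynomials in the squared variable.\<close>

lemma prod_alternating: "(\<Prod>s\<in>{1..2 * i}. [:1, (- 1) ^ s:]) = [:1, 0, - 1 :: rat:] ^ i"
proof (induction i)
  case (Suc i)
  have "{1..2 * Suc i} = insert (Suc (Suc (2 * i))) (insert (Suc (2 * i)) {1..2 * i})" by auto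
  then have "(\<Prod>s\<in>{1..2 * Suc i}. [:1, (- 1) ^ s:]) =
      [:1, 1:] * ([:1, - 1:] * (\<Prod>s\<in>{1..2 * i}. [:1, (- 1) ^ s :: rat:]))" by simp
  also have "\<dots> = ([:1, 1:] * [:1, - 1:]) * [:1, 0, - 1:] ^ i" by (simp only: Suc.IH mult.assoc)
  also have "[:1, 1:] * [:1, - 1:] = [:1, 0, - 1 :: rat:]" by simp
  finally show ?case by (simp only: power_Suc)
qed simp

lemma step_poly_even: "step_poly (2 * i) = [:1, - 1:] * at_square (base_poly i)"
proof -
  have "{1..Suc (2 * i)} = insert (Suc (2 * i)) {1..2 * i}" by auto
  then have "(\<Prod>s\<in>{1..Suc (2 * i)}. [:1, (- 1) ^ s:]) = [:1, - 1:] * [:1, 0, - 1 :: rat:] ^ i"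
    using prod_alternating[of i] by simp
  then show ?thesis by (simp only: step_poly_def at_square_base_poly mult_ac)
qed

lemma step_poly_odd: "step_poly (Suc (2 * i)) = monom 1 1 * at_square ([:1, - 1:] * base_poly i)"
proof -
  have "at_square [:1, - 1:] = [:1, 0, - 1 :: rat:]" by (simp add: pcompose_pCons)
  moreover have "monom 1 (Suc (2 * i)) = monom (1 :: rat) 1 * monom 1 (2 * i)" by (simp add: mult_monom)
  moreover have "step_poly (Suc (2 * i)) = monom 1 (Suc (2 * i)) * [:1, 0, - 1 :: rat:] ^ Suc i"
    unfolding step_poly_def prod_alternating[symmetric] by simp
  ultimately show ?thesis
    by (simp only: pcompose_mult at_square_base_poly power_Suc mult_ac)
qed

lemma coeff_step_poly_even:
  "coeff (step_poly (2 * i)) (2 * r) = coeff (base_poly i) r"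
  "coeff (step_poly (2 * i)) (Suc (2 * r)) = - coeff (base_poly i) r"
proof -
  have "[:1, - 1:] * p = p - pCons 0 p" for p :: "rat poly" by simp
  then have step: "step_poly (2 * i) = at_square (base_poly i) - pCons 0 (at_square (base_poly i))"
    by (simp only: step_poly_even)
  show "coeff (step_poly (2 * i)) (2 * r) = coeff (base_poly i) r"
    unfolding step by (cases r) (simp_all add: coeff_at_square del: coeff_pcompose_0)
  show "coeff (step_poly (2 * i)) (Suc (2 * r)) = - coeff (base_poly i) r"
    unfolding step by (simp add: coeff_at_square)
qed

lemma coeff_step_poly_odd:
  "coeff (step_poly (Suc (2 * i))) (2 * r) = 0"
  "coeff (step_poly (Suc (2 * i))) (Suc (2 * r)) = coeff ([:1, - 1:] * base_poly i) r"
  unfolding step_poly_odd coeff_monom_mult by (simp_all add: coeff_at_square)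

text \<open>By the factor \<open>1 - x\<close>, the coefficients at \<open>2 * r\<close> and
  \<open>Suc (2 * r)\<close> cancel.\<close>

lemma prefix_sum_step_poly_even:
  "prefix_sum (step_poly (2 * i)) (2 * r) = 0"
  "prefix_sum (step_poly (2 * i)) (Suc (2 * r)) = coeff (base_poly i) r"
proof -
  show "prefix_sum (step_poly (2 * i)) (2 * r) = 0" for r
    by (simp add: prefix_sum_def sum_lessThan_double coeff_step_poly_even)
  then show "prefix_sum (step_poly (2 * i)) (Suc (2 * r)) = coeff (base_poly i) r"
    by (simp add: prefix_sum_def coeff_step_poly_even)
qed

text \<open>Isotropy: at even positions the prefix sums vanish, and at odd positions the two
  products in \<open>pairing\<close> agree.\<close>

lemma pairing_even_even: "pairing (2 * b) (step_poly (2 * i)) (step_poly (2 * j)) = 0"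
  by (simp add: pairing_def sum_lessThan_double coeff_step_poly_even prefix_sum_step_poly_even)

lemma coeff_base_poly:
  "coeff (base_poly i) k = (if i \<le> k then (- 1) ^ (k - i) * of_nat (i choose (k - i)) else 0)"
  "coeff ([:1, - 1:] * base_poly i) k =
     (if i \<le> k then (- 1) ^ (k - i) * of_nat (Suc i choose (k - i)) else 0)"
proof -
  have power: "coeff ([:1, - 1 :: rat:] ^ n) k = (- 1) ^ k * of_nat (n choose k)" for n k
  proof (cases "k \<le> n")
    case False
    then show ?thesis using degree_power_le[of "[:1, - 1 :: rat:]" n] by (simp add: coeff_eq_0)
  qed (simp add: coeff_linear_poly_power)
  then show "coeff (base_poly i) k = (if i \<le> k then (- 1) ^ (k - i) * of_nat (i choose (k - i)) else 0)"
    unfolding base_poly_def coeff_monom_mult by (cases "i \<le> k") simp_all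
  have "[:1, - 1:] * base_poly i = monom 1 i * [:1, - 1:] ^ Suc i"
    by (simp only: base_poly_def power_Suc mult_ac)
  then have "coeff ([:1, - 1:] * base_poly i) k = (if k < i then 0 else coeff ([:1, - 1:] ^ Suc i) (k - i))"
    by (simp only: coeff_monom_mult mult_1_left)
  then show "coeff ([:1, - 1:] * base_poly i) k =
     (if i \<le> k then (- 1) ^ (k - i) * of_nat (Suc i choose (k - i)) else 0)"
    unfolding power by (simp only: not_le[symmetric] if_not_P if_P split: if_split) blast
qed

text \<open>The pairing collapses to the coefficientwise product of
  \<open>x^j (1 - x)^(j + 1)\<close> and \<open>x^i (1 - x)^i\<close>. Its terms have a common sign,
  and Vandermonde's convolution sums them. The bound keeps degree \<open>2 * i\<close> inside the
  truncation.\<close>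

lemma pairing_odd_even:
  assumes "2 * i < b"
  shows "pairing (2 * b) (step_poly (Suc (2 * j))) (step_poly (2 * i)) = (- 1) ^ (i + j) * entry j i"
proof -
  define q where "q = [:1, - 1:] * base_poly j"
  have coeff_q: "coeff q k = (if j \<le> k then (- 1) ^ (k - j) * of_nat (Suc j choose (k - j)) else 0)" for k
    unfolding q_def by (rule coeff_base_poly(2))
  let ?F = "\<lambda>k. coeff q k * coeff (base_poly i) k"
  let ?c = "\<lambda>k. (Suc j choose (k - j)) * (i choose (2 * i - k))"
  \<comment> \<open>The odd-index polynomial has equal prefix sums at \<open>2 * k\<close> and
    \<open>Suc (2 * k)\<close>; they meet opposite coefficients of the other polynomial and
    cancel.\<close>
  have "prefix_sum p (Suc r) = prefix_sum p r + coeff p r" for p :: "rat poly" and r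
    by (simp add: prefix_sum_def)
  then have "pairing (2 * b) (step_poly (Suc (2 * j))) (step_poly (2 * i)) = (\<Sum>k<b. ?F k)"
    unfolding pairing_def sum_lessThan_double
    by (simp only: coeff_step_poly_even coeff_step_poly_odd prefix_sum_step_poly_even flip: q_def) simp
  also have "\<dots> = (\<Sum>k\<in>{j..2 * i}. ?F k)"
    by (rule sum.mono_neutral_right) (use assms in \<open>auto simp: coeff_base_poly(1) coeff_q\<close>)
  also have "\<dots> = (\<Sum>k\<in>{j..2 * i}. (- 1) ^ (i + j) * of_nat (?c k))"
  proof (rule sum.cong[OF refl])
    fix k assume k: "k \<in> {j..2 * i}"
    show "?F k = (- 1) ^ (i + j) * of_nat (?c k)"
    proof (cases "i \<le> k")
      case True
      have "(k - j) + (k - i) + (i + j) = 2 * k" using k True by simp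
      then have "even ((k - j) + (k - i) + (i + j))" by (simp only: dvd_triv_left)
      then have "even ((k - j) + (k - i)) \<longleftrightarrow> even (i + j)" by (rule even_add[THEN iffD1])
      then have "(- 1 :: rat) ^ ((k - j) + (k - i)) = (- 1) ^ (i + j)"
        by (simp only: minus_one_power_iff)
      then have sign: "(- 1) ^ (k - j) * (- 1) ^ (k - i) = (- 1 :: rat) ^ (i + j)"
        by (simp only: power_add)
      \<comment> \<open>Reflecting this binomial gives lower indices \<open>k - j\<close> and
        \<open>2 * i - k\<close> of constant sum, as Vandermonde's convolution requires.\<close>
      have "k - i \<le> i" "i - (k - i) = 2 * i - k" using k True by auto
      then have choose: "i choose (k - i) = i choose (2 * i - k)"
        using binomial_symmetric[of "k - i" i] by (simp only:)
      have "j \<le> k" using k by simp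
      with True have "?F k = ((- 1) ^ (k - j) * of_nat (Suc j choose (k - j))) *
          ((- 1) ^ (k - i) * of_nat (i choose (k - i)))"
        by (simp only: coeff_base_poly(1) coeff_q if_True)
      also have "\<dots> = ((- 1) ^ (k - j) * (- 1) ^ (k - i)) *
          (of_nat (Suc j choose (k - j)) * of_nat (i choose (k - i)))"
        by (simp only: mult_ac)
      finally show ?thesis unfolding sign choose of_nat_mult .
    next
      case False
      then have "i < 2 * i - k" by simp
      with False show ?thesis by (simp add: coeff_base_poly(1) binomial_eq_0)
    qed
  qed
  also have "\<dots> = (- 1) ^ (i + j) * entry j i"
  proof (cases "j \<le> 2 * i")
    case True
    have "(\<Sum>k\<in>{j..2 * i}. ?c k) = (\<Sum>t\<le>2 * i - j. (Suc j choose t) * (i choose (2 * i - j - t)))"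
      by (rule sum.reindex_bij_witness[where i = "\<lambda>t. t + j" and j = "\<lambda>k. k - j"]) (use True in auto)
    also have "\<dots> = (i + j + 1) choose (2 * i - j)"
      by (subst vandermonde) (simp add: add.commute)
    finally have "(\<Sum>k\<in>{j..2 * i}. rat_of_nat (?c k)) = entry j i"
      using True unfolding of_nat_sum[symmetric] by (simp only: entry_eq_binomial if_True)
    then show ?thesis by (simp only: sum_distrib_left[symmetric])
  next
    case False
    then have "{j..2 * i} = {}" by simp
    then show ?thesis using False by (simp only: entry_eq_binomial if_False sum.empty mult_zero_right)
  qed
  finally show ?thesis .
qed

lemma pfaffian_expand_pair:
  assumes "\<And>q. q \<in> set ps \<Longrightarrow> \<omega> x q = 0"
  shows "pfaffian \<omega> (x # y # ps) = \<omega> x y * pfaffian \<omega> ps"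
proof -
  have "(\<Sum>j<length ps. (- 1) ^ Suc j * \<omega> x (ps ! j) * pfaffian \<omega> (y # del_nth j ps)) = 0"
    using assms by (intro sum.neutral) simp
  then show ?thesis using pfaffian_split[of \<omega> x "[]" y ps] by (simp del: pfaffian.simps)
qed

text \<open>Skew elimination: \<open>step_poly (2 * m)\<close> is replaced by a vector
  \<open>o'\<close> orthogonal to all of \<open>?rest\<close>, to the even indices by isotropy and
  to the odd ones by \<open>residual_below\<close>. The pivot then splits off.\<close>

lemma pfaffian_step_polys:
  assumes "2 * m \<le> b"
  shows "pfaffian (pairing (2 * b)) (map step_poly (rev [0..<2 * m])) = (\<Prod>k<m. pivot k)"
  using assms
proof (induction m)
  case (Suc m)
  let ?\<omega> = "pairing (2 * b) :: rat poly \<Rightarrow> _" and ?rest = "map step_poly (rev [0..<2 * m])"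
  let ?e = "step_poly (Suc (2 * m))"
  \<comment> \<open>The kernel scaled to \<open>c m = 1\<close>; its sign turns the sign in
    \<open>pairing_odd_even\<close> into one independent of \<open>i\<close>.\<close>
  define c where "c i = (- 1) ^ (i + m) * kernel m i / kernel m m" for i
  define o' where "o' = step_poly (2 * m) + (\<Sum>i<m. smult (c i) (step_poly (2 * i)))"
  note \<Phi> = pairing.alternating_form_pfaffian[of "2 * b"]
  have right: "?\<omega> p o' = (\<Sum>i\<le>m. c i * ?\<omega> p (step_poly (2 * i)))" for p
  proof -
    have add: "?\<omega> p (x + y) = ?\<omega> p x + ?\<omega> p y" for x y
      using pairing.linear_right[of "2 * b" p 1 x y] by simp
    have "?\<omega> p (\<Sum>i<n. smult (c i) (step_poly (2 * i))) = (\<Sum>i<n. c i * ?\<omega> p (step_poly (2 * i)))" for n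
    proof (induction n)
      case 0
      show ?case using add[of 0 0] by simp
    next
      case (Suc n)
      then show ?case using pairing.linear_right[of "2 * b" p "c n" "step_poly (2 * n)"
            "\<Sum>i<n. smult (c i) (step_poly (2 * i))"]
        by (simp add: add.commute)
    qed
    moreover have "c m = 1" using kernel_nonzero[of m m] by (simp add: c_def power_add)
    moreover have "(\<Sum>i\<le>m. f i) = f m + (\<Sum>i<m. f i)" for f :: "nat \<Rightarrow> rat"
      by (simp add: lessThan_Suc_atMost[symmetric] add.commute)
    ultimately show ?thesis by (simp add: o'_def add)
  qed
  have regroup: "(u * v / w) * (x * y) = (u * x) / w * (v * y)" for u v w x y :: rat
    by simp
  have odd: "?\<omega> (step_poly (Suc (2 * j))) o' = (- 1) ^ (j + m) * residual m j / kernel m m" for j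
  proof -
    have "c i * ?\<omega> (step_poly (Suc (2 * j))) (step_poly (2 * i)) =
        (- 1) ^ (j + m) / kernel m m * (kernel m i * entry j i)" if "i \<le> m" for i
    proof -
      have "2 * i < b" using that Suc.prems by simp
      have "(i + m) + (i + j) = 2 * i + (j + m)" by simp
      then have sign: "(- 1) ^ (i + m) * (- 1) ^ (i + j) = (- 1 :: rat) ^ (j + m)"
        by (simp only: power_add[symmetric]) (simp add: power_add)
      have "c i * ?\<omega> (step_poly (Suc (2 * j))) (step_poly (2 * i)) =
          ((- 1) ^ (i + m) * (- 1) ^ (i + j)) / kernel m m * (kernel m i * entry j i)"
        unfolding pairing_odd_even[OF \<open>2 * i < b\<close>] c_def by (rule regroup)
      then show ?thesis unfolding sign .
    qed
    then have "(\<Sum>i\<le>m. c i * ?\<omega> (step_poly (Suc (2 * j))) (step_poly (2 * i))) =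
        (\<Sum>i\<le>m. (- 1) ^ (j + m) / kernel m m * (kernel m i * entry j i))"
      by (intro sum.cong refl) simp
    then show ?thesis
      unfolding right residual_def sum_distrib_left[symmetric] by simp
  qed
  have even: "?\<omega> (step_poly (2 * j)) o' = 0" for j
    by (simp add: right pairing_even_even)
  have orthogonal: "?\<omega> o' q = 0" if "q \<in> set ?rest" for q
  proof -
    obtain i where i: "i < 2 * m" "q = step_poly i" using \<open>q \<in> set ?rest\<close> by auto
    have "?\<omega> (step_poly i) o' = 0"
    proof (cases "even i")
      case True
      then obtain j where "i = 2 * j" by (rule evenE)
      then show ?thesis by (simp only: even)
    next
      case False
      then obtain j where j: "i = Suc (2 * j)" unfolding Suc_eq_plus1 by (rule oddE)
      with i have "residual m j = 0" by (intro residual_below) simp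
      then show ?thesis unfolding j odd by simp
    qed
    then show ?thesis using pairing_commute[of "2 * b" o' "step_poly i"] i by simp
  qed
  have expand: "pfaffian ?\<omega> (o' # ?e # ?rest) = ?\<omega> o' ?e * pfaffian ?\<omega> ?rest"
    using orthogonal by (rule pfaffian_expand_pair)
  have mem: "step_poly (2 * i) \<in> set ?rest" if "i \<in> {..<m}" for i using that by auto
  have "rev [0..<2 * Suc m] = Suc (2 * m) # 2 * m # rev [0..<2 * m]" by simp
  then have "pfaffian ?\<omega> (map step_poly (rev [0..<2 * Suc m])) =
      pfaffian ?\<omega> (?e # step_poly (2 * m) # ?rest)" by (simp only: list.map)
  also have "\<dots> = pfaffian ?\<omega> (?e # o' # ?rest)"
    using alternating_form_add_combination[OF \<Phi> finite_lessThan mem, where as = "[?e]" and y = "step_poly (2 * m)" and c = c]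
    unfolding o'_def append_Cons append_Nil by (rule sym)
  \<comment> \<open>\<open>o'\<close> goes to the front so that the expansion runs along it;
    antisymmetry of the pairing then undoes the sign.\<close>
  also have "\<dots> = - pfaffian ?\<omega> (o' # ?e # ?rest)"
    using alternating_form_swap[OF \<Phi>, of "[]"] by (simp only: append_Nil)
  also have "\<dots> = ?\<omega> ?e o' * pfaffian ?\<omega> ?rest"
    unfolding expand pairing_commute[of "2 * b" o' ?e] by (simp del: pfaffian.simps)
  finally have "pfaffian ?\<omega> (map step_poly (rev [0..<2 * Suc m])) = ?\<omega> ?e o' * pfaffian ?\<omega> ?rest" .
  moreover have "?\<omega> ?e o' = pivot m"
  proof -
    have "(- 1 :: rat) ^ (m + m) = 1" by (simp only: power_add minus_one_mult_self)
    then show ?thesis using kernel_nonzero[of m m] odd[of m] unfolding residual_diag by (simp only: nonzero_mult_div_cancel_left order_refl mult_1_left simp_thms)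
  qed
  moreover have "pfaffian ?\<omega> ?rest = (\<Prod>k<m. pivot k)" using Suc by simp
  ultimately show ?case by (simp only: prod.lessThan_Suc mult.commute)
qed simp

subsection \<open>Ideals of cells\<close>

text \<open>Here \<open>k\<close> is the difference of the two large coordinates of a point, so decreasing only the
  smaller of them turns \<open>(b + 1, k)\<close> into \<open>(b, k + 1)\<close>.\<close>

definition ideals :: "nat \<Rightarrow> (nat \<times> nat \<times> nat) set set" where
  "ideals N = {S. (\<forall>a b k. (a, b, k) \<in> S \<longrightarrow> a + b + k < N) \<and>
     (\<forall>a b k. (Suc a, b, k) \<in> S \<longrightarrow> (a, b, k) \<in> S) \<and>
     (\<forall>a b k. (a, Suc b, k) \<in> S \<longrightarrow> (a, b, Suc k) \<in> S) \<and>
     (\<forall>a b k. (a, b, Suc k) \<in> S \<longrightarrow> (a, b, k) \<in> S)}"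

lemma
  assumes "S \<in> ideals N"
  shows ideals_bound: "(a, b, k) \<in> S \<Longrightarrow> a + b + k < N"
    and ideals_Suc1: "(Suc a, b, k) \<in> S \<Longrightarrow> (a, b, k) \<in> S"
    and ideals_Suc2: "(a, Suc b, k) \<in> S \<Longrightarrow> (a, b, Suc k) \<in> S"
    and ideals_Suc3: "(a, b, Suc k) \<in> S \<Longrightarrow> (a, b, k) \<in> S"
  using assms unfolding ideals_def mem_Collect_eq by blast+

text \<open>In the coordinates \<open>a\<close>, \<open>b\<close> and \<open>b + k\<close> this is
  the product order: lower \<open>a\<close>, then trade \<open>b\<close> for \<open>k\<close>, then
  lower \<open>k\<close>.\<close>

lemma ideals_down:
  assumes S: "S \<in> ideals N" and "(a, b, k) \<in> S" "a' \<le> a" "b' \<le> b" "b' + k' \<le> b + k"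
  shows "(a', b', k') \<in> S"
proof -
  have 1: "(a - n, b, k) \<in> S" for n
  proof (induction n)
    case (Suc n)
    then show ?case using ideals_Suc1[OF S, of "a - Suc n" b k]
      by (cases "n < a") (simp_all add: Suc_diff_Suc)
  qed (use assms in simp)
  have 2: "(a', b - n, k + n) \<in> S" if "n \<le> b" for n
    using that
  proof (induction n)
    case 0
    then show ?case using 1[of "a - a'"] assms by simp
  next
    case (Suc n)
    then show ?case using ideals_Suc2[OF S, of a' "b - Suc n" "k + n"] by (simp add: Suc_diff_Suc)
  qed
  have 3: "(a', b', k + (b - b') - n) \<in> S" for n
  proof (induction n)
    case 0
    then show ?case using 2[of "b - b'"] assms by simp
  next
    case (Suc n)
    then show ?case using ideals_Suc3[OF S, of a' b' "k + (b - b') - Suc n"]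
      by (cases "n < k + (b - b')") (simp_all add: Suc_diff_Suc)
  qed
  show ?thesis using 3[of "k + (b - b') - k'"] assms by simp
qed

section \<open>Column heights and the passage from ideals to histories\<close>

definition height :: "(nat \<times> nat \<times> nat) set \<Rightarrow> nat \<Rightarrow> nat \<Rightarrow> nat" where
  "height S a k = card {b. (a, b, k) \<in> S}"

text \<open>By \<open>ideals_down\<close> with \<open>a\<close> and \<open>k\<close> fixed, each
  column is an initial segment of the naturals.\<close>

lemma less_height_iff:
  assumes S: "S \<in> ideals N"
  shows "b < height S a k \<longleftrightarrow> (a, b, k) \<in> S"
proof -
  let ?H = "{b. (a, b, k) \<in> S}"
  have sub: "?H \<subseteq> {..<N}" by (auto dest: ideals_bound[OF S])
  then have fin: "finite ?H" by (rule finite_subset) simp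
  have down: "b' \<in> ?H" if "b \<in> ?H" "b' \<le> b" for b b'
    using that ideals_down[OF S, of a b k a b' k] by simp
  show ?thesis
  proof
    assume "b < height S a k"
    show "(a, b, k) \<in> S"
    proof (rule ccontr)
      assume "(a, b, k) \<notin> S"
      then have "x < b" if "x \<in> ?H" for x using down[OF that, of b] by (cases "x < b") auto
      then have "?H \<subseteq> {..<b}" by auto
      from card_mono[OF _ this] \<open>b < height S a k\<close> show False by (simp add: height_def)
    qed
  next
    assume "(a, b, k) \<in> S"
    then have "{..b} \<subseteq> ?H" using down by auto
    from card_mono[OF fin this] show "b < height S a k" by (simp add: height_def)
  qed
qed

text \<open>Successive slices interlace: when \<open>k\<close> drops by one, a height stays or grows
  by one, which is the choice of one particle whether to jump.\<close>

lemma height_steps: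
  assumes S: "S \<in> ideals N"
  shows "height S a (Suc k) \<le> height S a k" "height S a k \<le> Suc (height S a (Suc k))"
    "height S (Suc a) k \<le> height S a k" "N \<le> a + k \<Longrightarrow> height S a k = 0"
proof -
  note iff = less_height_iff[OF S]
  show "height S a (Suc k) \<le> height S a k"
    using iff[of "height S a k" a k] iff[of "height S a k" a "Suc k"] ideals_Suc3[OF S] by (auto simp: not_less)
  show "height S a k \<le> Suc (height S a (Suc k))"
  proof (rule ccontr)
    assume "\<not> ?thesis"
    then have "Suc (height S a (Suc k)) < height S a k" by simp
    then have "(a, Suc (height S a (Suc k)), k) \<in> S" using iff by blast
    from ideals_Suc2[OF S this] show False using iff by blast
  qed
  show "height S (Suc a) k \<le> height S a k"
    using iff[of "height S a k" a k] iff[of "height S a k" "Suc a" k] ideals_Suc1[OF S] by (auto simp: not_less)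
  show "N \<le> a + k \<Longrightarrow> height S a k = 0"
    using iff[of 0 a k] ideals_bound[OF S, of a 0 k] by force
qed

text \<open>Time \<open>t\<close> corresponds to the slice \<open>k = N - t\<close>, and the rank of
  a particle to the height of its column.\<close>

definition ideal_of :: "nat \<Rightarrow> (nat \<times> nat) set \<Rightarrow> (nat \<times> nat \<times> nat) set" where
  "ideal_of N E = {(a, b, k). k < N \<and> b < rank E a (N - k)}"

definition history_of :: "nat \<Rightarrow> (nat \<times> nat \<times> nat) set \<Rightarrow> (nat \<times> nat) set" where
  "history_of N S = {(a, t). a < t \<and> t \<le> N \<and> height S a (Suc N - t) < height S a (N - t)}"

lemma rank_history_of:
  assumes S: "S \<in> ideals N" and "t \<le> N"
  shows "rank (history_of N S) a t = height S a (N - t)"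
  using \<open>t \<le> N\<close>
proof (induction t)
  case 0
  have "rank (history_of N S) a 0 = 0" by (rule rank_0[of _ N]) (auto simp: history_of_def)
  then show ?case using height_steps(4)[OF S, of a N] by simp
next
  case (Suc t)
  let ?k = "N - Suc t"
  have k: "N - t = Suc ?k" "Suc N - Suc t = Suc ?k" using Suc.prems by auto
  \<comment> \<open>The condition \<open>a < Suc t\<close> is automatic: otherwise the height at
    \<open>?k\<close> is \<open>0\<close> and cannot have grown.\<close>
  have "(a, Suc t) \<in> history_of N S \<longleftrightarrow> height S a (Suc ?k) < height S a ?k"
    using Suc.prems height_steps(4)[OF S, of a ?k] k
    unfolding history_of_def mem_Collect_eq prod.case by (cases "a < Suc t") auto
  then show ?case
    using Suc height_steps(1,2)[OF S, of a ?k] by (auto simp: rank_Suc k)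
qed

lemma history_of_in_histories:
  assumes S: "S \<in> ideals N"
  shows "history_of N S \<in> histories N"
proof -
  have sub: "history_of N S \<subseteq> {(a, t). a < t \<and> t \<le> N}" by (auto simp: history_of_def)
  have "rank (history_of N S) (Suc a) t \<le> rank (history_of N S) a t" for a t
  proof (cases "t \<le> N")
    case True
    then show ?thesis by (simp add: rank_history_of[OF S] height_steps(3)[OF S])
  next
    case False
    then show ?thesis
      using rank_beyond[OF sub, of t] by (simp add: rank_history_of[OF S] height_steps(3)[OF S])
  qed
  with sub show ?thesis by (simp add: histories_def)
qed

lemma ideal_of_in_ideals:
  assumes "E \<in> histories N"
  shows "ideal_of N E \<in> ideals N"
proof -
  have E: "E \<subseteq> {(a, t). a < t \<and> t \<le> N}" "\<And>a t. rank E (Suc a) t \<le> rank E a t"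
    using assms by (auto simp: histories_def)
  have step: "rank E a (N - Suc k) \<le> rank E a (N - k)" "rank E a (N - k) \<le> Suc (rank E a (N - Suc k))"
    for a k
    using rank_mono[of "N - Suc k" "N - k" E a] rank_Suc[of E a "N - Suc k"]
    by (cases "k < N"; simp add: Suc_diff_Suc)+
  show ?thesis
    unfolding ideals_def ideal_of_def
  proof (clarsimp, intro conjI allI impI)
    fix a b k assume *: "k < N \<and> b < rank E a (N - k)"
    with rank_le[OF E(1), of a "N - k"] show "a + b + k < N" by auto
  next
    fix a b k assume "k < N \<and> b < rank E (Suc a) (N - k)"
    with E(2)[of a "N - k"] show "b < rank E a (N - k)" by simp
  next
    fix a b k assume *: "k < N \<and> Suc b < rank E a (N - k)"
    with rank_le[OF E(1), of a "N - k"] show "Suc k < N" by auto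
    from * step(2)[of a k] show "b < rank E a (N - Suc k)" by simp
  next
    fix a b k assume "Suc k < N \<and> b < rank E a (N - Suc k)"
    with step(1)[of a k] show "b < rank E a (N - k)" by simp
  qed
qed

lemma height_ideal_of:
  assumes "E \<in> histories N"
  shows "height (ideal_of N E) a k = rank E a (N - k)"
proof (cases "k < N")
  case True
  then have "{b. (a, b, k) \<in> ideal_of N E} = {..<rank E a (N - k)}"
    by (auto simp: ideal_of_def)
  then show ?thesis by (simp add: height_def)
next
  case False
  with assms show ?thesis
    using rank_0[of E N a] by (simp add: height_def ideal_of_def histories_def)
qed

lemma history_of_ideal_of:
  assumes "E \<in> histories N"
  shows "history_of N (ideal_of N E) = E"
proof -
  have E: "E \<subseteq> {(a, t). a < t \<and> t \<le> N}" using assms by (auto simp: histories_def)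
  have "rank E a (N - (Suc N - t)) < rank E a (N - (N - t)) \<longleftrightarrow> (a, t) \<in> E" if at: "a < t" "t \<le> N" for a t
  proof -
    obtain t' where t: "t = Suc t'" using at by (cases t) auto
    then have "N - (Suc N - t) = t'" "N - (N - t) = Suc t'" using at by auto
    then show ?thesis by (simp add: rank_Suc t)
  qed
  with E show ?thesis unfolding history_of_def height_ideal_of[OF assms] by blast
qed

lemma ideal_of_history_of:
  assumes S: "S \<in> ideals N"
  shows "ideal_of N (history_of N S) = S"
proof -
  have "(a, b, k) \<in> ideal_of N (history_of N S) \<longleftrightarrow> (a, b, k) \<in> S" for a b k
    using ideals_bound[OF S, of a b k] by (auto simp: ideal_of_def rank_history_of[OF S] less_height_iff[OF S])
  then show ?thesis by auto
qed

text \<open>Double counting: a jump at time \<open>t\<close> adds one cell to each of the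
  \<open>Suc N - t\<close> slices with \<open>k \<le> N - t\<close>.\<close>

lemma card_ideal:
  assumes S: "S \<in> ideals N"
  shows "card S = (\<Sum>(a, t)\<in>history_of N S. Suc N - t)"
proof -
  let ?E = "history_of N S"
  have finE: "finite ?E"
    by (rule finite_subset[OF _ finite_triangle[of N]]) (auto simp: history_of_def)
  have "card S = card (SIGMA p:{..<N} \<times> {..<N}. {b. (fst p, b, snd p) \<in> S})"
    by (rule bij_betw_same_card[of "\<lambda>(a, b, k). ((a, k), b)"],
        rule bij_betw_byWitness[where f' = "\<lambda>((a, k), b). (a, b, k)"])
      (auto dest: ideals_bound[OF S])
  also have "\<dots> = (\<Sum>p\<in>{..<N} \<times> {..<N}. height S (fst p) (snd p))"
    by (subst card_SigmaI) (auto simp: height_def intro!: finite_subset[of _ "{..<N}"] dest: ideals_bound[OF S])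
  also have "\<dots> = (\<Sum>a<N. \<Sum>k<N. height S a k)"
    by (simp add: sum.cartesian_product split_def)
  also have "\<dots> = (\<Sum>a<N. \<Sum>k<N. rank ?E a (N - k))"
    by (intro sum.cong refl) (simp add: rank_history_of[OF S])
  also have "\<dots> = (\<Sum>a<N. \<Sum>k<N. card {s. s \<le> N - k \<and> (a, s) \<in> ?E})"
    by (simp add: rank_def)
  also have "\<dots> = card (SIGMA p:{..<N} \<times> {..<N}. {s. s \<le> N - snd p \<and> (fst p, s) \<in> ?E})"
    by (subst card_SigmaI) (auto simp: sum.cartesian_product split_def intro!: finite_subset[of _ "{..N}"])
  also have "\<dots> = card (SIGMA (a, t):?E. {..<Suc N - t})"
    by (rule bij_betw_same_card[of "\<lambda>((a, k), s). ((a, s), k)"],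
        rule bij_betw_byWitness[where f' = "\<lambda>((a, s), k). ((a, k), s)"])
      (auto simp: history_of_def)
  also have "\<dots> = (\<Sum>(a, t)\<in>?E. Suc N - t)"
    by (subst card_SigmaI) (auto simp: finE intro!: sum.cong)
  finally show ?thesis .
qed

lemma sum_ideals:
  "(\<Sum>S\<in>ideals N. (- 1) ^ card S) = (\<Sum>E\<in>histories N. \<Prod>(a, t)\<in>E. (- 1 :: 'a::comm_ring_1) ^ (Suc N - t))"
proof (rule sum.reindex_bij_witness[where i = "ideal_of N" and j = "history_of N"])
  fix S assume S: "S \<in> ideals N"
  show "(\<Prod>(a, t)\<in>history_of N S. (- 1 :: 'a) ^ (Suc N - t)) = (- 1) ^ card S"
    unfolding card_ideal[OF S] power_sum by (intro prod.cong) auto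
qed (simp_all add: ideal_of_history_of history_of_ideal_of ideal_of_in_ideals history_of_in_histories)

subsection \<open>Totally symmetric self-complementary plane partitions\<close>

definition low :: "point \<Rightarrow> nat" where "low = (\<lambda>(i, j, k). min i (min j k))"
definition mid :: "point \<Rightarrow> nat" where "mid = (\<lambda>(i, j, k). max (min i j) (max (min i k) (min j k)))"
definition high :: "point \<Rightarrow> nat" where "high = (\<lambda>(i, j, k). max i (max j k))"

text \<open>A canonical representative of each orbit; a symmetric set is determined by its sorted
  points.\<close>

definition sorted_point :: "point \<Rightarrow> point" where
  "sorted_point x = (low x, mid x, high x)"

lemmas sorted_point_defs = sorted_point_def low_def mid_def high_def

lemma self_in_orbit: "x \<in> S3_orbit x"
  by (cases x) simp

lemma sorted_point_id: "i \<le> j \<Longrightarrow> j \<le> k \<Longrightarrow> sorted_point (i, j, k) = (i, j, k)"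
  by (simp add: sorted_point_defs)

lemma sorted_point_swap:
  "sorted_point (j, i, k) = sorted_point (i, j, k)" "sorted_point (i, k, j) = sorted_point (i, j, k)"
  by (simp_all add: sorted_point_defs min.commute min.left_commute max.commute max.left_commute)

lemma S3_orbit_swap:
  "S3_orbit (j, i, k) = S3_orbit (i, j, k)" "S3_orbit (i, k, j) = S3_orbit (i, j, k)"
  by auto

lemma sorted_point_orbit: "y \<in> S3_orbit x \<Longrightarrow> sorted_point y = sorted_point x"
  by (cases x) (auto intro: sorted_point_swap sorted_point_swap[THEN trans])

lemma S3_orbit_sorted_point: "S3_orbit (sorted_point x) = S3_orbit x"
proof -
  have sorted: "S3_orbit (sorted_point (i, j, k)) = S3_orbit (i, j, k)" if "i \<le> j" "j \<le> k" for i j k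
    using that by (simp only: sorted_point_id)
  obtain i j k where x: "x = (i, j, k)" by (cases x)
  consider "i \<le> j" "j \<le> k" | "i \<le> k" "k \<le> j" | "j \<le> i" "i \<le> k" | "j \<le> k" "k \<le> i"
    | "k \<le> i" "i \<le> j" | "k \<le> j" "j \<le> i" by linarith
  then show ?thesis
    unfolding x by cases (metis sorted sorted_point_swap S3_orbit_swap)+
qed

lemma sorted_point_eqD:
  assumes "sorted_point y = sorted_point x"
  shows "low y = low x" "mid y = mid x" "high y = high x"
  using assms by (simp_all add: sorted_point_def)

lemma sorted_point_in_orbit: "sorted_point x \<in> S3_orbit x"
  using self_in_orbit[of "sorted_point x"] by (simp only: S3_orbit_sorted_point)

lemma low_le_mid: "low x \<le> mid x" and mid_le_high: "mid x \<le> high x"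
  by (cases x; simp add: low_def mid_def high_def; linarith)+

lemma cube_iff: "x \<in> cube m \<longleftrightarrow> 1 \<le> low x \<and> high x \<le> m"
  by (cases x) (auto simp: cube_def low_def high_def)

definition opposite :: "nat \<Rightarrow> point \<Rightarrow> point" where
  "opposite m = (\<lambda>(i, j, k). (m + 1 - i, m + 1 - j, m + 1 - k))"

lemma opposite_sorted:
  "low (opposite m x) = m + 1 - high x" "mid (opposite m x) = m + 1 - mid x"
  "high (opposite m x) = m + 1 - low x"
proof -
  obtain i j k where x: "x = (i, j, k)" by (cases x)
  let ?c = "m + 1"
  have minus: "min (?c - i) (?c - j) = ?c - max i j" "max (?c - i) (?c - j) = ?c - min i j" for i j
    by (cases "i \<le> j"; simp)+
  \<comment> \<open>Complementation exchanges minima and maxima, so the formula for the median has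
    to be self-dual.\<close>
  have median: "min (max i j) (min (max i k) (max j k)) = max (min i j) (max (min i k) (min j k))"
    by (cases "i \<le> j"; cases "j \<le> k"; cases "i \<le> k") simp_all
  show "low (opposite m x) = ?c - high x" "high (opposite m x) = ?c - low x"
    unfolding x opposite_def low_def high_def prod.case minus by (rule refl)+
  show "mid (opposite m x) = ?c - mid x"
    unfolding x opposite_def mid_def prod.case minus median by (rule refl)
qed

lemma opposite_in_cube: "x \<in> cube m \<Longrightarrow> opposite m x \<in> cube m"
  unfolding cube_iff opposite_sorted by linarith

lemma self_complementary_iff:
  "self_complementary m P \<longleftrightarrow> (\<forall>x\<in>cube m. x \<in> P \<longleftrightarrow> opposite m x \<notin> P)"
  by (simp add: self_complementary_def opposite_def split_beta)

lemma totally_symmetric_iff: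
  "totally_symmetric P \<longleftrightarrow> (\<forall>x. x \<in> P \<longleftrightarrow> sorted_point x \<in> P)"
proof
  assume P: "totally_symmetric P"
  show "\<forall>x. x \<in> P \<longleftrightarrow> sorted_point x \<in> P"
  proof (intro allI iffI)
    fix x assume "x \<in> P"
    then show "sorted_point x \<in> P"
      using P sorted_point_in_orbit[of x] unfolding totally_symmetric_def by blast
  next
    fix x assume "sorted_point x \<in> P"
    then have "S3_orbit x \<subseteq> P"
      using P S3_orbit_sorted_point[of x] by (metis totally_symmetric_def)
    then show "x \<in> P" using self_in_orbit[of x] by blast
  qed
next
  assume "\<forall>x. x \<in> P \<longleftrightarrow> sorted_point x \<in> P"
  then show "totally_symmetric P"
    unfolding totally_symmetric_def using sorted_point_orbit by (metis subsetI)
qed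

section \<open>Partitions as ideals of cells\<close>

definition cell :: "nat \<Rightarrow> nat \<times> nat \<times> nat \<Rightarrow> point" where
  "cell \<alpha> = (\<lambda>(a, b, k). (Suc a, \<alpha> + Suc b, \<alpha> + Suc b + k))"

definition cells :: "nat \<Rightarrow> point set \<Rightarrow> (nat \<times> nat \<times> nat) set" where
  "cells \<alpha> P = {p. cell \<alpha> p \<in> P}"

definition coord :: "nat \<Rightarrow> point \<Rightarrow> nat \<times> nat \<times> nat" where
  "coord \<alpha> x = (low x - 1, mid x - \<alpha> - 1, high x - mid x)"

text \<open>A point with median at most \<open>\<alpha>\<close> has an opposite with larger median,
  and self-complementarity decides it through that opposite.\<close>

definition tsscpp_of :: "nat \<Rightarrow> (nat \<times> nat \<times> nat) set \<Rightarrow> point set" where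
  "tsscpp_of \<alpha> S = {x \<in> cube (2 * \<alpha>).
     if \<alpha> < mid x then coord \<alpha> x \<in> S else coord \<alpha> (opposite (2 * \<alpha>) x) \<notin> S}"

lemma cell_coord:
  assumes "1 \<le> low x" "\<alpha> < mid x"
  shows "cell \<alpha> (coord \<alpha> x) = sorted_point x"
  using assms mid_le_high[of x] by (simp add: cell_def coord_def sorted_point_def)

lemma mid_opposite:
  assumes "x \<in> cube (2 * \<alpha>)"
  shows "\<alpha> < mid (opposite (2 * \<alpha>) x) \<longleftrightarrow> \<not> \<alpha> < mid x"
  using assms low_le_mid[of x] mid_le_high[of x] by (auto simp: cube_iff opposite_sorted)

lemma opposite_opposite: "x \<in> cube m \<Longrightarrow> opposite m (opposite m x) = x"
  by (cases x) (simp add: opposite_def cube_def)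

lemma
  assumes "P \<in> TSSCPP \<alpha>"
  shows TSSCPP_cube: "P \<subseteq> cube (2 * \<alpha>)"
    and TSSCPP_sorted: "x \<in> P \<longleftrightarrow> sorted_point x \<in> P"
    and TSSCPP_opposite: "x \<in> cube (2 * \<alpha>) \<Longrightarrow> x \<in> P \<longleftrightarrow> opposite (2 * \<alpha>) x \<notin> P"
  using assms unfolding TSSCPP_def totally_symmetric_iff self_complementary_iff mem_Collect_eq by blast+

lemma TSSCPP_down:
  assumes "P \<in> TSSCPP \<alpha>" "x \<in> P" "1 \<le> low y" "low y \<le> low x" "mid y \<le> mid x" "high y \<le> high x"
  shows "y \<in> P"
proof -
  note sym = TSSCPP_sorted[OF assms(1)]
  have down: "(i', j', k') \<in> P"
    if "(i, j, k) \<in> P" "1 \<le> i'" "i' \<le> i" "1 \<le> j'" "j' \<le> j" "1 \<le> k'" "k' \<le> k" for i j k i' j' k'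
    using assms(1) that unfolding TSSCPP_def plane_partition_def mem_Collect_eq by blast
  have "(low x, mid x, high x) \<in> P" using assms(2) sym[of x] by (simp add: sorted_point_def)
  then have "(low y, mid y, high y) \<in> P"
    by (rule down) (use assms low_le_mid[of y] mid_le_high[of y] in linarith)+
  then show ?thesis using sym[of y] by (simp add: sorted_point_def)
qed

lemma cells_in_ideals:
  assumes P: "P \<in> TSSCPP \<alpha>"
  shows "cells \<alpha> P \<in> ideals (\<alpha> - 1)"
proof -
  note cube = TSSCPP_cube[OF P] and compl = TSSCPP_opposite[OF P]
  have down: "(i', j', k') \<in> P"
    if "(i, j, k) \<in> P" "1 \<le> i'" "i' \<le> i" "1 \<le> j'" "j' \<le> j" "1 \<le> k'" "k' \<le> k" for i j k i' j' k'
    using P that unfolding TSSCPP_def plane_partition_def mem_Collect_eq by blast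
  have bound: "a + b + k < \<alpha> - 1" if "(Suc a, \<alpha> + Suc b, \<alpha> + Suc b + k) \<in> P" for a b k
  proof (rule ccontr)
    let ?x = "(Suc a, \<alpha> + Suc b, \<alpha> + Suc b + k)"
    assume neg: "\<not> ?thesis"
    have x: "?x \<in> cube (2 * \<alpha>)" using that cube by auto
    \<comment> \<open>Outside the bound, the least and greatest coordinates add up to more than
      \<open>2 * \<alpha>\<close>. The opposite point then lies below \<open>?x\<close> and would
      belong to \<open>P\<close> as well.\<close>
    have large: "2 * \<alpha> + 1 \<le> low ?x + high ?x" "\<alpha> < mid ?x"
      using neg by (auto simp: low_def mid_def high_def min_def max_def)
    have "opposite (2 * \<alpha>) ?x \<in> P"
    proof (rule TSSCPP_down[OF P that])
      show "1 \<le> low (opposite (2 * \<alpha>) ?x)"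
        using opposite_in_cube[OF x] by (simp add: cube_iff)
      show "low (opposite (2 * \<alpha>) ?x) \<le> low ?x" "mid (opposite (2 * \<alpha>) ?x) \<le> mid ?x"
        "high (opposite (2 * \<alpha>) ?x) \<le> high ?x"
        unfolding opposite_sorted using large by linarith+
    qed
    with compl[OF x] that show False by simp
  qed
  show ?thesis
    unfolding ideals_def cells_def cell_def mem_Collect_eq prod.case
    by (intro conjI allI impI bound; (erule down)?; simp)
qed

lemma tsscpp_of_in_TSSCPP:
  assumes S: "S \<in> ideals (\<alpha> - 1)"
  shows "tsscpp_of \<alpha> S \<in> TSSCPP \<alpha>"
proof -
  let ?P = "tsscpp_of \<alpha> S" and ?opp = "opposite (2 * \<alpha>)"
  have coord_down: "coord \<alpha> y \<in> S"
    if "coord \<alpha> x \<in> S" "\<alpha> < mid x" "\<alpha> < mid y" "low y \<le> low x" "mid y \<le> mid x" "high y \<le> high x" for x y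
  proof -
    have "mid y - \<alpha> - 1 + (high y - mid y) \<le> mid x - \<alpha> - 1 + (high x - mid x)"
      using that mid_le_high[of x] mid_le_high[of y] by linarith
    then show ?thesis
      unfolding coord_def by (intro ideals_down[OF S that(1)[unfolded coord_def]]) (use that in linarith)+
  qed
  have coord_bound: "low x + high x \<le> 2 * \<alpha>" if "coord \<alpha> x \<in> S" "\<alpha> < mid x" for x
    using ideals_bound[OF S that(1)[unfolded coord_def]] that(2) mid_le_high[of x] by linarith
  have down: "y \<in> ?P"
    if x: "x \<in> ?P" and y: "1 \<le> low y" "low y \<le> low x" "mid y \<le> mid x" "high y \<le> high x" for x y
  proof -
    have cube: "x \<in> cube (2 * \<alpha>)" "y \<in> cube (2 * \<alpha>)"
      using x y by (auto simp: tsscpp_of_def cube_iff)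
    note mids = mid_opposite[OF cube(1)] mid_opposite[OF cube(2)]
    \<comment> \<open>Large medians are compared in \<open>S\<close>, small ones through their
      opposites, where the order is reversed. In the mixed case, \<open>coord_bound\<close> for
      \<open>x\<close> and for the opposite of \<open>y\<close> would contradict each other.\<close>
    consider "\<alpha> < mid y" | "\<not> \<alpha> < mid y" "\<alpha> < mid x" | "\<not> \<alpha> < mid x" "\<not> \<alpha> < mid y"
      using y by linarith
    then show ?thesis
    proof cases
      case 1
      then have "\<alpha> < mid x" using y by linarith
      then have "coord \<alpha> x \<in> S" using x by (simp add: tsscpp_of_def)
      then have "coord \<alpha> y \<in> S" using 1 \<open>\<alpha> < mid x\<close> y by (intro coord_down[of x y])
      then show ?thesis using 1 cube by (simp add: tsscpp_of_def)
    next
      case 2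
      then have "coord \<alpha> x \<in> S" using x by (simp add: tsscpp_of_def)
      then have "low x + high x \<le> 2 * \<alpha>" using 2 by (intro coord_bound)
      moreover have False if "coord \<alpha> (?opp y) \<in> S" and less: "low x + high x \<le> 2 * \<alpha>"
      proof -
        have "low (?opp y) + high (?opp y) \<le> 2 * \<alpha>"
          using that(1) 2 mids by (intro coord_bound) simp_all
        then show False
          using less y cube unfolding opposite_sorted cube_iff by linarith
      qed
      ultimately have "coord \<alpha> (?opp y) \<notin> S" by blast
      then show ?thesis using 2 cube by (simp add: tsscpp_of_def)
    next
      case 3
      then have "coord \<alpha> (?opp x) \<notin> S" using x by (simp add: tsscpp_of_def)
      moreover have "coord \<alpha> (?opp x) \<in> S" if "coord \<alpha> (?opp y) \<in> S"
        using that 3 mids y by (intro coord_down[of "?opp y" "?opp x"]) (auto simp: opposite_sorted)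
      ultimately show ?thesis using 3 cube by (auto simp: tsscpp_of_def)
    qed
  qed
  have mono: "low (i', j', k') \<le> low (i, j, k)" "mid (i', j', k') \<le> mid (i, j, k)"
    "high (i', j', k') \<le> high (i, j, k)" if "i' \<le> i" "j' \<le> j" "k' \<le> k" for i j k i' j' k'
    unfolding low_def mid_def high_def prod.case by (intro min.mono max.mono that)+
  have sub: "?P \<subseteq> cube (2 * \<alpha>)" by (auto simp: tsscpp_of_def)
  have "plane_partition ?P"
    unfolding plane_partition_def
  proof (intro conjI allI impI)
    show "finite ?P" using sub by (rule finite_subset) (simp add: cube_def)
  next
    fix i j k assume "(i, j, k) \<in> ?P"
    then have "(i, j, k) \<in> cube (2 * \<alpha>)" using sub by blast
    then show "1 \<le> i" "1 \<le> j" "1 \<le> k" by (auto simp: cube_def)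
  next
    fix i j k i' j' k' assume *: "(i, j, k) \<in> ?P" "1 \<le> i'" "i' \<le> i" "1 \<le> j'" "j' \<le> j" "1 \<le> k'" "k' \<le> k"
    then have "1 \<le> low (i', j', k')" by (simp add: low_def)
    with * show "(i', j', k') \<in> ?P" by (intro down[OF *(1)] mono)
  qed
  moreover have "totally_symmetric ?P"
  proof -
    have "x \<in> ?P \<longleftrightarrow> sorted_point x \<in> ?P" for x
      using sorted_point_eqD[OF sorted_point_orbit[OF sorted_point_in_orbit[of x]]]
      by (simp add: tsscpp_of_def cube_iff coord_def opposite_sorted)
    then show ?thesis unfolding totally_symmetric_iff by blast
  qed
  moreover have "x \<in> ?P \<longleftrightarrow> ?opp x \<notin> ?P" if x: "x \<in> cube (2 * \<alpha>)" for x
    using mid_opposite[OF x] opposite_in_cube[OF x] opposite_opposite[OF x] x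
    by (cases "\<alpha> < mid x") (simp_all add: tsscpp_of_def)
  then have "self_complementary (2 * \<alpha>) ?P"
    unfolding self_complementary_iff by blast
  ultimately show ?thesis using sub by (simp add: TSSCPP_def)
qed

lemma tsscpp_of_cells:
  assumes P: "P \<in> TSSCPP \<alpha>"
  shows "tsscpp_of \<alpha> (cells \<alpha> P) = P"
proof -
  note sym = TSSCPP_sorted[OF P] and cube = TSSCPP_cube[OF P] and compl = TSSCPP_opposite[OF P]
  have coord: "coord \<alpha> x \<in> cells \<alpha> P \<longleftrightarrow> x \<in> P" if "x \<in> cube (2 * \<alpha>)" "\<alpha> < mid x" for x
    using that sym[of x] by (simp add: cells_def cell_coord cube_iff)
  have "x \<in> tsscpp_of \<alpha> (cells \<alpha> P) \<longleftrightarrow> x \<in> P" for x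
  proof (cases "x \<in> cube (2 * \<alpha>)")
    case True
    then show ?thesis
      using coord[OF True] coord[OF opposite_in_cube[OF True]] mid_opposite[OF True] compl[OF True]
      by (auto simp: tsscpp_of_def)
  next
    case False
    then show ?thesis using cube by (auto simp: tsscpp_of_def)
  qed
  then show ?thesis by blast
qed

lemma cell_sorted:
  assumes "a + b + k < \<alpha> - 1"
  shows "low (cell \<alpha> (a, b, k)) = Suc a" "mid (cell \<alpha> (a, b, k)) = \<alpha> + Suc b"
    "high (cell \<alpha> (a, b, k)) = \<alpha> + Suc b + k" "coord \<alpha> (cell \<alpha> (a, b, k)) = (a, b, k)"
    "cell \<alpha> (a, b, k) \<in> cube (2 * \<alpha>)"
  using assms by (auto simp: cell_def low_def mid_def high_def coord_def cube_def)

lemma cells_tsscpp_of: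
  assumes S: "S \<in> ideals (\<alpha> - 1)"
  shows "cells \<alpha> (tsscpp_of \<alpha> S) = S"
proof -
  have "(a, b, k) \<in> cells \<alpha> (tsscpp_of \<alpha> S) \<longleftrightarrow> (a, b, k) \<in> S" for a b k
  proof (cases "a + b + k < \<alpha> - 1")
    case True
    then show ?thesis using cell_sorted[OF True] by (simp add: cells_def tsscpp_of_def)
  next
    case False
    then show ?thesis
      using ideals_bound[OF cells_in_ideals[OF tsscpp_of_in_TSSCPP[OF S]], of a b k] ideals_bound[OF S, of a b k]
      by blast
  qed
  then show ?thesis by auto
qed

text \<open>Each orbit contains exactly one sorted point, and it leaves \<open>P0 \<alpha>\<close>
  exactly when its median exceeds \<open>\<alpha>\<close>.\<close>

lemma n_orbits_eq_card_cells:
  assumes P: "P \<in> TSSCPP \<alpha>"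
  shows "n_orbits \<alpha> P = card (cells \<alpha> P)"
proof -
  have sym: "totally_symmetric P" and cube: "P \<subseteq> cube (2 * \<alpha>)"
    using P by (auto simp: TSSCPP_def)
  have orbit_sub: "S3_orbit x \<subseteq> P \<longleftrightarrow> x \<in> P" for x
    using sym self_in_orbit[of x] unfolding totally_symmetric_def by blast
  have P0: "\<not> S3_orbit x \<subseteq> P0 \<alpha> \<longleftrightarrow> \<alpha> < mid x" if x: "x \<in> cube (2 * \<alpha>)" for x
  proof -
    have "y \<in> P0 \<alpha> \<longleftrightarrow> \<not> \<alpha> < mid y" if "y \<in> cube (2 * \<alpha>)" for y
      using that by (cases y) (simp add: P0_def mid_def less_max_iff_disj)
    moreover have "y \<in> cube (2 * \<alpha>) \<and> mid y = mid x" if "y \<in> S3_orbit x" for y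
      using sorted_point_eqD[OF sorted_point_orbit[OF that]] x by (simp add: cube_iff)
    ultimately show ?thesis using self_in_orbit[of x] unfolding subset_iff by metis
  qed
  have bound: "a + b + k < \<alpha> - 1" if "(a, b, k) \<in> cells \<alpha> P" for a b k
    using ideals_bound[OF cells_in_ideals[OF P] that] .
  have "bij_betw (\<lambda>p. S3_orbit (cell \<alpha> p)) (cells \<alpha> P)
      {orb \<in> S3_orbit ` cube (2 * \<alpha>). orb \<subseteq> P \<and> \<not> orb \<subseteq> P0 \<alpha>}"
    unfolding bij_betw_def
  proof (intro conjI inj_onI equalityI subsetI)
    fix p q assume pq: "p \<in> cells \<alpha> P" "q \<in> cells \<alpha> P" "S3_orbit (cell \<alpha> p) = S3_orbit (cell \<alpha> q)"
    then have "sorted_point (cell \<alpha> p) = sorted_point (cell \<alpha> q)"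
      using self_in_orbit sorted_point_orbit by metis
    then have "coord \<alpha> (cell \<alpha> p) = coord \<alpha> (cell \<alpha> q)"
      by (simp add: sorted_point_def coord_def)
    moreover have "coord \<alpha> (cell \<alpha> r) = r" if "r \<in> cells \<alpha> P" for r
      using that cell_sorted(4)[OF bound] by (cases r) simp
    ultimately show "p = q" using pq by metis
  next
    fix orb assume "orb \<in> (\<lambda>p. S3_orbit (cell \<alpha> p)) ` cells \<alpha> P"
    then obtain a b k where p: "(a, b, k) \<in> cells \<alpha> P" and orb: "orb = S3_orbit (cell \<alpha> (a, b, k))"
      by auto
    have "cell \<alpha> (a, b, k) \<in> P" using p by (simp add: cells_def)
    moreover have "\<alpha> < mid (cell \<alpha> (a, b, k))" using cell_sorted(2)[OF bound[OF p]] by simp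
    moreover have "cell \<alpha> (a, b, k) \<in> cube (2 * \<alpha>)" by (rule cell_sorted(5)[OF bound[OF p]])
    ultimately show "orb \<in> {orb \<in> S3_orbit ` cube (2 * \<alpha>). orb \<subseteq> P \<and> \<not> orb \<subseteq> P0 \<alpha>}"
      unfolding orb mem_Collect_eq orbit_sub by (intro conjI imageI) (simp_all add: P0)
  next
    fix orb assume "orb \<in> {orb \<in> S3_orbit ` cube (2 * \<alpha>). orb \<subseteq> P \<and> \<not> orb \<subseteq> P0 \<alpha>}"
    then obtain x where "x \<in> cube (2 * \<alpha>)" "orb = S3_orbit x" "S3_orbit x \<subseteq> P"
      "\<not> S3_orbit x \<subseteq> P0 \<alpha>" by blast
    then have x: "x \<in> cube (2 * \<alpha>)" "orb = S3_orbit x" "x \<in> P" "\<alpha> < mid x"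
      by (simp_all only: orbit_sub P0)
    have eq: "cell \<alpha> (coord \<alpha> x) = sorted_point x"
      using x by (intro cell_coord) (auto simp: cube_iff)
    moreover have "sorted_point x \<in> P" using TSSCPP_sorted[OF P] x(3) by blast
    ultimately have "coord \<alpha> x \<in> cells \<alpha> P" by (simp add: cells_def)
    moreover have "orb = S3_orbit (cell \<alpha> (coord \<alpha> x))"
      unfolding eq S3_orbit_sorted_point by (rule x(2))
    ultimately show "orb \<in> (\<lambda>p. S3_orbit (cell \<alpha> p)) ` cells \<alpha> P" by blast
  qed
  from bij_betw_same_card[OF this] show ?thesis by (simp add: n_orbits_def)
qed

lemma sum_TSSCPP:
  "(\<Sum>P\<in>TSSCPP \<alpha>. (- 1) ^ n_orbits \<alpha> P) = (\<Sum>S\<in>ideals (\<alpha> - 1). (- 1 :: 'a::comm_ring_1) ^ card S)"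
  by (rule sum.reindex_bij_witness[where i = "tsscpp_of \<alpha>" and j = "cells \<alpha>"])
    (simp_all add: tsscpp_of_cells cells_tsscpp_of cells_in_ideals tsscpp_of_in_TSSCPP n_orbits_eq_card_cells
      del: One_nat_def)

theorem theorem5:
  fixes \<alpha> :: nat
  assumes "\<alpha> \<ge> 1"
  shows "(\<Sum>P\<in>TSSCPP \<alpha>. (- 1) ^ n_orbits \<alpha> P) =
    (if odd \<alpha>
     then \<Prod>k = 1..(\<alpha> - 1) div 2. (fact (6 * k - 2) :: rat) / fact (2 * k + \<alpha> - 1)
     else 0)"
proof -
  define N where "N = \<alpha> - 1"
  have \<alpha>: "\<alpha> = Suc N" using assms by (simp add: N_def)
  \<comment> \<open>A jump at time \<open>t\<close> stands for \<open>Suc N - t\<close> cells, each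
    of sign \<open>- 1\<close>.\<close>
  define w where "w t = (- 1 :: rat) ^ (Suc N - t)" for t
  have sum: "(\<Sum>P\<in>TSSCPP \<alpha>. (- 1 :: rat) ^ n_orbits \<alpha> P) = (\<Sum>E\<in>histories N. \<Prod>(a, t)\<in>E. w t)"
    unfolding sum_TSSCPP sum_ideals N_def[symmetric] w_def ..
  show ?thesis
  \<comment> \<open>\<open>N\<close> and \<open>\<alpha>\<close> have opposite parities, so odd
    \<open>N\<close> is the vanishing case.\<close>
  proof (cases "odd N")
    case True
    have "w N = - 1" by (simp add: w_def)
    with True have "(\<Sum>E\<in>histories N. \<Prod>(a, t)\<in>E. w t) = 0" by (rule sum_histories_odd)
    with True show ?thesis unfolding sum by (simp add: \<alpha>)
  next
    case False
    then have "even N" by simp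
    then obtain m where m: "N = 2 * m" by (rule evenE)
    have "(\<Sum>E\<in>histories N. \<Prod>(a, t)\<in>E. w t) =
        pfaffian (pairing (2 * N)) (map (particle_poly w N) [0..<N])"
      by (rule sum_histories_even) (simp_all add: m)
    also have "map (particle_poly w N) [0..<N] = map step_poly (rev [0..<N])"
      unfolding w_def by (rule map_particle_poly)
    also have "pfaffian (pairing (2 * N)) (map step_poly (rev [0..<N])) = (\<Prod>k<m. pivot k)"
      unfolding m by (rule pfaffian_step_polys) simp
    also have "\<dots> = (\<Prod>k = 1..m. fact (6 * k - 2) / fact (2 * k + 2 * m))"
      by (rule prod_pivot)
    finally show ?thesis unfolding sum by (simp add: \<alpha> m)
  qed
qed

end
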